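(* There exists an algorithm that, given an arbitrary pair $(w,w')$ of words over a countably infinite alphabet $X$, decides whether or not the identity $w\bumpeq w'$ holds in the Kauffman monoid $\mathcal{K}_3$, and whose running time is bounded by a polynomial in the sum of the lengths of $w$ and $w'$.
   Context: The Kauffman monoid $\mathcal{K}_3$ is the monoid given by the presentation $$\mathcal{K}_3=\langle c,h_1,h_2\mid h_1h_2h_1=h_1,\ h_2h_1h_2=h_2,\ h_1^2=ch_1=h_1c,\ h_2^2=ch_2=h_2c\rangle .$$ $X^*$ is the free monoid over $X$ (finite words, including the empty word). An identity is a formal expression $w\bumpeq w'$ with $w,w'\in X^*$; it holds in a monoid $\mathcal{M}$ if every monoid homomorphism $\varphi\colon X^*\to\mathcal{M}$ takes the same value on $w$ and $w'$. The size of an instance $(w,w')$ is measured by the sum of the lengths of $w$ and $w'$, with elementary operations on letters (such as comparing two letters) counted as single steps. *)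

theory Defs
  imports
    "HOL-Algebra.Group"
    "HOL-Library.Countable"
    "HOL-Library.Infinite_Typeclass"
    "HOL-Computational_Algebra.Polynomial"
begin

section \<open>Monoids given by presentations\<close>

inductive mcong :: "('g list \<times> 'g list) set \<Rightarrow> 'g list \<Rightarrow> 'g list \<Rightarrow> bool"
  for R where
  rel: "(u, v) \<in> R \<Longrightarrow> mcong R u v"
| refl: "mcong R u u"
| sym: "mcong R u v \<Longrightarrow> mcong R v u"
| trans: "mcong R u v \<Longrightarrow> mcong R v w \<Longrightarrow> mcong R u w"
| mult: "mcong R u u' \<Longrightarrow> mcong R v v' \<Longrightarrow> mcong R (u @ v) (u' @ v')"

definition mcong_rel :: "('g list \<times> 'g list) set \<Rightarrow> ('g list \<times> 'g list) set" where
  "mcong_rel R = {(u, v). mcong R u v}"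

definition presented_monoid :: "('g list \<times> 'g list) set \<Rightarrow> 'g list set monoid" where
  "presented_monoid R =
    \<lparr>carrier = UNIV // mcong_rel R,
     monoid.mult = (\<lambda>A B. \<Union>a\<in>A. \<Union>b\<in>B. mcong_rel R `` {a @ b}),
     one = mcong_rel R `` {[]}\<rparr>"

lemma equiv_mcong_rel: "equiv UNIV (mcong_rel R)"
proof (rule equivI)
  show "refl (mcong_rel R)"
    by (simp add: mcong_rel_def refl_on_def mcong.refl)
  show "sym (mcong_rel R)"
    unfolding mcong_rel_def sym_def by (blast intro: mcong.sym)
  show "trans (mcong_rel R)"
    unfolding mcong_rel_def trans_def by (blast intro: mcong.trans)
qed simp

lemma mult_presented_monoid:
  "mcong_rel R `` {u} \<otimes>\<^bsub>presented_monoid R\<^esub> mcong_rel R `` {v} = mcong_rel R `` {u @ v}"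
proof -
  have eq: "mcong_rel R `` {a @ b} = mcong_rel R `` {u @ v}"
    if "a \<in> mcong_rel R `` {u}" "b \<in> mcong_rel R `` {v}" for a b
  proof -
    have "mcong R (u @ v) (a @ b)"
      using that by (intro mcong.mult) (simp_all add: mcong_rel_def)
    then have "(u @ v, a @ b) \<in> mcong_rel R"
      by (simp add: mcong_rel_def)
    then show ?thesis
      using equiv_class_eq[OF equiv_mcong_rel] by metis
  qed
  have "u \<in> mcong_rel R `` {u}" "v \<in> mcong_rel R `` {v}"
    by (simp_all add: mcong_rel_def mcong.refl)
  with eq show ?thesis
    unfolding presented_monoid_def monoid.simps by blast
qed

lemma monoid_presented_monoid: "monoid (presented_monoid R)"
proof -
  have carr: "carrier (presented_monoid R) = range (\<lambda>u. mcong_rel R `` {u})"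
    by (auto simp: presented_monoid_def quotient_def)
  have one: "\<one>\<^bsub>presented_monoid R\<^esub> = mcong_rel R `` {[]}"
    by (simp add: presented_monoid_def)
  show ?thesis
    by (rule monoidI) (auto simp: carr one mult_presented_monoid)
qed

datatype kgen = C | H1 | H2

definition K3_relations :: "(kgen list \<times> kgen list) set" where
  "K3_relations =
    {([H1, H2, H1], [H1]), ([H2, H1, H2], [H2]),
     ([H1, H1], [C, H1]), ([C, H1], [H1, C]),
     ([H2, H2], [C, H2]), ([C, H2], [H2, C])}"

definition K3 :: "kgen list set monoid" where
  "K3 = presented_monoid K3_relations"


section \<open>Identities\<close>

definition free_monoid :: "'x list monoid" where
  "free_monoid = \<lparr>carrier = UNIV, monoid.mult = (@), one = []\<rparr>"

text \<open>The library's \<^const>\<open>hom\<close> does not require preservation of the unit.\<close>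

definition identity_holds :: "('m, 'b) monoid_scheme \<Rightarrow> 'x list \<Rightarrow> 'x list \<Rightarrow> bool" where
  "identity_holds M w w' \<longleftrightarrow>
    (\<forall>\<phi> \<in> hom free_monoid M. \<phi> \<one>\<^bsub>free_monoid\<^esub> = \<one>\<^bsub>M\<^esub> \<longrightarrow> \<phi> w = \<phi> w')"


section \<open>Programs and their running time\<close>

text \<open>
  Algorithms are programs of Jones's language WHILE (N. D. Jones, Computability and Complexity
  from a Programming Perspective, MIT Press 1997), whose data are binary trees built from atoms.
  Its polynomial-time computable problems over a finite set of atoms are those of Turing machines.
  Here the atoms are the empty tree and the letters. A program does not mention any letter; the
  only operation that inspects letters is the equality test \<open>EqLetter\<close>, which compares just two
  single letters, so that each operation is realised in constant time on trees represented by
  pointers. The empty tree stands for false and any other tree for true.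
\<close>

datatype 'x tree = Null | Letter 'x | Node "'x tree" "'x tree"

datatype expr =
    Var nat
  | NullE
  | NodeE expr expr
  | Left expr
  | Right expr
  | EqLetter expr expr

datatype com =
    Skip
  | Assign nat expr
  | Seq com com
  | If expr com com
  | While expr com

type_synonym 'x state = "nat \<Rightarrow> 'x tree"

fun left :: "'x tree \<Rightarrow> 'x tree" where
  "left (Node s t) = s"
| "left _ = Null"

fun right :: "'x tree \<Rightarrow> 'x tree" where
  "right (Node s t) = t"
| "right _ = Null"

fun eq_letter :: "'x tree \<Rightarrow> 'x tree \<Rightarrow> 'x tree" where
  "eq_letter (Letter x) (Letter y) = (if x = y then Node Null Null else Null)"
| "eq_letter _ _ = Null"

primrec eval_expr :: "expr \<Rightarrow> 'x state \<Rightarrow> 'x tree" where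
  "eval_expr (Var i) \<sigma> = \<sigma> i"
| "eval_expr NullE \<sigma> = Null"
| "eval_expr (NodeE e f) \<sigma> = Node (eval_expr e \<sigma>) (eval_expr f \<sigma>)"
| "eval_expr (Left e) \<sigma> = left (eval_expr e \<sigma>)"
| "eval_expr (Right e) \<sigma> = right (eval_expr e \<sigma>)"
| "eval_expr (EqLetter e f) \<sigma> = eq_letter (eval_expr e \<sigma>) (eval_expr f \<sigma>)"

primrec cost :: "expr \<Rightarrow> nat" where
  "cost (Var i) = 1"
| "cost NullE = 1"
| "cost (NodeE e f) = cost e + cost f + 1"
| "cost (Left e) = cost e + 1"
| "cost (Right e) = cost e + 1"
| "cost (EqLetter e f) = cost e + cost f + 1"

text \<open>\<open>runs p \<sigma> n \<tau>\<close>: started in \<open>\<sigma>\<close>, the program \<open>p\<close> halts in \<open>\<tau>\<close> after \<open>n\<close> steps.\<close>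

inductive runs :: "com \<Rightarrow> 'x state \<Rightarrow> nat \<Rightarrow> 'x state \<Rightarrow> bool" where
  Skip: "runs Skip \<sigma> 1 \<sigma>"
| Assign: "runs (Assign i e) \<sigma> (cost e + 1) (\<sigma>(i := eval_expr e \<sigma>))"
| Seq: "runs p \<sigma> m \<rho> \<Longrightarrow> runs q \<rho> n \<tau> \<Longrightarrow> runs (Seq p q) \<sigma> (m + n) \<tau>"
| IfTrue: "eval_expr e \<sigma> \<noteq> Null \<Longrightarrow> runs p \<sigma> n \<tau> \<Longrightarrow> runs (If e p q) \<sigma> (cost e + 1 + n) \<tau>"
| IfFalse: "eval_expr e \<sigma> = Null \<Longrightarrow> runs q \<sigma> n \<tau> \<Longrightarrow> runs (If e p q) \<sigma> (cost e + 1 + n) \<tau>"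
| WhileFalse: "eval_expr e \<sigma> = Null \<Longrightarrow> runs (While e p) \<sigma> (cost e + 1) \<sigma>"
| WhileTrue: "eval_expr e \<sigma> \<noteq> Null \<Longrightarrow> runs p \<sigma> m \<rho> \<Longrightarrow> runs (While e p) \<rho> n \<tau>
    \<Longrightarrow> runs (While e p) \<sigma> (cost e + 1 + m + n) \<tau>"

inductive_cases runs_SkipE: "runs Skip \<sigma> n \<tau>"
inductive_cases runs_AssignE: "runs (Assign i e) \<sigma> n \<tau>"
inductive_cases runs_SeqE: "runs (Seq p q) \<sigma> n \<tau>"
inductive_cases runs_IfE: "runs (If e p q) \<sigma> n \<tau>"
inductive_cases runs_WhileE: "runs (While e p) \<sigma> n \<tau>"

lemma runs_deterministic:
  "runs p \<sigma> n \<tau> \<Longrightarrow> runs p \<sigma> n' \<tau>' \<Longrightarrow> n' = n \<and> \<tau>' = \<tau>"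
proof (induction arbitrary: n' \<tau>' rule: runs.induct)
  case (Skip \<sigma>)
  then show ?case by (elim runs_SkipE) simp
next
  case (Assign i e \<sigma>)
  then show ?case by (elim runs_AssignE) simp
next
  case (Seq p \<sigma> m \<rho> q n \<tau>)
  show ?case by (rule runs_SeqE[OF Seq.prems]) (metis Seq.IH)
next
  case (IfTrue e \<sigma> p n \<tau> q)
  show ?case by (rule runs_IfE[OF IfTrue.prems]) (simp, metis IfTrue.IH IfTrue.hyps(1))+
next
  case (IfFalse e \<sigma> q n \<tau> p)
  show ?case by (rule runs_IfE[OF IfFalse.prems]) (simp, metis IfFalse.IH IfFalse.hyps(1))+
next
  case (WhileFalse e \<sigma> p)
  show ?case by (rule runs_WhileE[OF WhileFalse.prems]) (simp_all add: WhileFalse.hyps)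
next
  case (WhileTrue e \<sigma> p m \<rho> n \<tau>)
  show ?case by (rule runs_WhileE[OF WhileTrue.prems]) (simp, metis WhileTrue.IH WhileTrue.hyps(1))+
qed

primrec tree_of_word :: "'x list \<Rightarrow> 'x tree" where
  "tree_of_word [] = Null"
| "tree_of_word (x # w) = Node (Letter x) (tree_of_word w)"

definition input :: "'x list \<Rightarrow> 'x list \<Rightarrow> 'x state" where
  "input w w' = (\<lambda>_. Null)(0 := tree_of_word w, 1 := tree_of_word w')"

text \<open>The answer of a program is read from variable 0.\<close>

definition decides_in_time ::
    "com \<Rightarrow> ('x list \<Rightarrow> 'x list \<Rightarrow> bool) \<Rightarrow> (nat \<Rightarrow> nat) \<Rightarrow> bool" where
  "decides_in_time p Q T \<longleftrightarrow>
    (\<forall>w w'. \<exists>n \<tau>. runs p (input w w') n \<tau> \<and> n \<le> T (length w + length w') \<and>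
      (\<tau> 0 \<noteq> Null \<longleftrightarrow> Q w w'))"

end

theory Submission
  imports Defs "HOL-Library.Multiset"
begin

text \<open>
  Apart from the powers of \<open>c\<close>, every element of \<open>K3\<close> is \<open>c^k e_ij\<close> with \<open>i, j\<close> in a two-element
  set, where \<open>e_11 = h_1\<close>, \<open>e_22 = h_2\<close>, \<open>e_12 = h_1 h_2\<close>, \<open>e_21 = h_2 h_1\<close>; and \<open>e_ij e_kl\<close> is
  \<open>c e_il\<close> if \<open>j = k\<close> and \<open>e_il\<close> otherwise. A substitution therefore chooses a set of letters that
  become powers of \<open>c\<close> and are as good as deleted, and for each remaining letter \<open>x\<close> two bits \<open>i x\<close>,
  \<open>j x\<close>. The value of a word then records the bits at both ends of what is left of it, and the number
  of adjacent pairs \<open>x y\<close> with \<open>j x = i y\<close>. Letting the bits vary isolates the number of occurrences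
  of each single pair. Thus the identity \<open>(w, w')\<close> holds iff for each set \<open>Z\<close> of letters, deleting
  \<open>Z\<close> from \<open>w\<close> and from \<open>w'\<close> leaves words with the same multiset of adjacent pairs, where the two
  borders of a word count as neighbours of its end letters (\<open>identity_holds_K3_iff_adj\<close>).

  There are exponentially many \<open>Z\<close>, but it is enough to try the contents of the factors of \<open>w\<close> and
  \<open>w'\<close>, of which there are quadratically many (\<open>adj_eq_if_adj_eq_factors\<close>). Two occurrences of letters
  \<open>p, q\<close> outside \<open>Z\<close> become adjacent exactly when the set of letters between them is
  contained in \<open>Z\<close>. So the number of adjacent pairs after deletion counts the members below \<open>Z\<close> in a
  multiset of contents of factors, and a multiset over any partial order is determined by how many
  members lie below each of its own members (\<open>mset_eqI_down_set_sizes\<close>).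

  The program runs through all factors and compares the two multisets of pairs for each by removing
  equal entries one by one. It is verified with a weakest-precondition calculus (\<open>exec\<close>) whose
  postconditions speak of the running time as well as of the final state, and one rule for
  loops over lists (\<open>exec_foreach\<close>).
\<close>

section \<open>Identities of a presented monoid\<close>

text \<open>
  A homomorphism from the free monoid is determined by its values on letters, and each value is the
  class of some word over the generators.
\<close>

lemma identity_holds_presented_monoid:
  fixes R :: "('g list \<times> 'g list) set" and w w' :: "'x list"
  shows "identity_holds (presented_monoid R) w w' \<longleftrightarrow>
    (\<forall>u. mcong R (concat (map u w)) (concat (map u w')))"
proof
  let ?M = "presented_monoid R" and ?c = "\<lambda>v. mcong_rel R `` {v}"
  {
    assume holds: "identity_holds ?M w w'"
    show "\<forall>u. mcong R (concat (map u w)) (concat (map u w'))"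
    proof
      fix u :: "'x \<Rightarrow> 'g list"
      let ?\<phi> = "\<lambda>v. ?c (concat (map u v))"
      have "?\<phi> \<in> hom free_monoid ?M"
        by (auto simp: hom_def free_monoid_def mult_presented_monoid)
          (auto simp: presented_monoid_def quotient_def)
      moreover have "?\<phi> \<one>\<^bsub>free_monoid\<^esub> = \<one>\<^bsub>?M\<^esub>"
        by (simp add: free_monoid_def presented_monoid_def)
      ultimately have "?\<phi> w = ?\<phi> w'"
        using holds[unfolded identity_holds_def, rule_format, of ?\<phi>] by simp
      then have "(concat (map u w), concat (map u w')) \<in> mcong_rel R"
        by (rule eq_equiv_class[OF _ equiv_mcong_rel]) simp
      then show "mcong R (concat (map u w)) (concat (map u w'))"
        by (simp add: mcong_rel_def)
    qed
  next
    assume all: "\<forall>u. mcong R (concat (map u w)) (concat (map u w'))"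
    show "identity_holds ?M w w'"
      unfolding identity_holds_def
    proof (intro ballI impI)
      fix \<phi> :: "'x list \<Rightarrow> 'g list set"
      assume hom: "\<phi> \<in> hom free_monoid ?M" and one: "\<phi> \<one>\<^bsub>free_monoid\<^esub> = \<one>\<^bsub>?M\<^esub>"
      have "\<exists>v. \<phi> [x] = ?c v" for x
        using hom by (auto simp: hom_def free_monoid_def presented_monoid_def quotient_def Pi_iff)
      then obtain u where u: "\<And>x. \<phi> [x] = ?c (u x)"
        by metis
      have \<phi>: "\<phi> v = ?c (concat (map u v))" for v
      proof (induction v)
        case Nil
        then show ?case
          using one by (simp add: free_monoid_def presented_monoid_def)
      next
        case (Cons x v)
        have "\<phi> (x # v) = \<phi> [x] \<otimes>\<^bsub>?M\<^esub> \<phi> v"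
          using hom_mult[OF hom, of "[x]" v] by (simp add: free_monoid_def)
        then show ?case
          by (simp add: u Cons.IH mult_presented_monoid)
      qed
      have "(concat (map u w), concat (map u w')) \<in> mcong_rel R"
        using all by (simp add: mcong_rel_def)
      then show "\<phi> w = \<phi> w'"
        unfolding \<phi> by (rule equiv_class_eq[OF equiv_mcong_rel])
    qed
  }
qed

section \<open>A matrix model of the Kauffman monoid\<close>

text \<open>
  The pair \<open>(k, None)\<close> stands for \<open>c^k\<close>, and \<open>(k, Some (i, j))\<close> for \<open>c^k e_ij\<close>: a Rees matrix
  semigroup over the powers of \<open>c\<close> with sandwich matrix \<open>(c 1; 1 c)\<close>, together with these powers
  themselves.
\<close>

fun kmult :: "nat \<times> (bool \<times> bool) option \<Rightarrow> nat \<times> (bool \<times> bool) option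
    \<Rightarrow> nat \<times> (bool \<times> bool) option" where
  "kmult (k, None) (l, b) = (k + l, b)"
| "kmult (k, Some a) (l, None) = (k + l, Some a)"
| "kmult (k, Some (i, j)) (l, Some (i', j')) = (k + l + of_bool (j = i'), Some (i, j'))"

lemma kmult_assoc: "kmult (kmult a b) d = kmult a (kmult b d)"
  by (cases "(a, b)" rule: kmult.cases; cases "(b, d)" rule: kmult.cases;
      cases "(a, d)" rule: kmult.cases) auto

lemma kmult_unit [simp]: "kmult a (0, None) = a"
  "kmult (0, None) a = a"
  by (cases "(a, a)" rule: kmult.cases; simp)+

primrec kgen_value :: "kgen \<Rightarrow> nat \<times> (bool \<times> bool) option" where
  "kgen_value C = (1, None)"
| "kgen_value H1 = (0, Some (False, False))"
| "kgen_value H2 = (0, Some (True, True))"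

definition kprod :: "('a \<Rightarrow> nat \<times> (bool \<times> bool) option) \<Rightarrow> 'a list \<Rightarrow> nat \<times> (bool \<times> bool) option" where
  "kprod \<theta> w = foldr (\<lambda>x. kmult (\<theta> x)) w (0, None)"

lemma kprod_simps [simp]:
  "kprod \<theta> [] = (0, None)"
  "kprod \<theta> (x # w) = kmult (\<theta> x) (kprod \<theta> w)"
  by (simp_all add: kprod_def)

lemma kprod_append [simp]: "kprod \<theta> (v @ w) = kmult (kprod \<theta> v) (kprod \<theta> w)"
  by (induction v) (simp_all add: kmult_assoc)

lemma kprod_concat: "kprod \<theta> (concat (map u w)) = kprod (\<lambda>x. kprod \<theta> (u x)) w"
  by (induction w) simp_all

fun normal_word :: "nat \<times> (bool \<times> bool) option \<Rightarrow> kgen list" where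
  "normal_word (k, None) = replicate k C"
| "normal_word (k, Some (False, False)) = replicate k C @ [H1]"
| "normal_word (k, Some (True, True)) = replicate k C @ [H2]"
| "normal_word (k, Some (False, True)) = replicate k C @ [H1, H2]"
| "normal_word (k, Some (True, False)) = replicate k C @ [H2, H1]"

lemma kprod_replicate_C [simp]: "kprod kgen_value (replicate k C) = (k, None)"
  by (induction k) simp_all

lemma kprod_normal_word [simp]: "kprod kgen_value (normal_word m) = m"
  by (cases m rule: normal_word.cases) simp_all

lemma mcong_kprod: "mcong K3_relations u v \<Longrightarrow> kprod kgen_value u = kprod kgen_value v"
  by (induction rule: mcong.induct) (auto simp: K3_relations_def)

lemma mcong_append: "mcong R u v \<Longrightarrow> mcong R (s @ u @ t) (s @ v @ t)"
  by (intro mcong.mult mcong.refl)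

lemma mcong_C_commute:
  "mcong K3_relations (h # replicate k C @ v) (replicate k C @ h # v)"
proof (induction k)
  case (Suc k)
  have "mcong K3_relations [h, C] [C, h]"
    by (cases h) (auto intro: mcong.refl mcong.rel mcong.sym simp: K3_relations_def)
  then have "mcong K3_relations (h # C # replicate k C @ v) (C # h # replicate k C @ v)"
    using mcong_append[of _ "[h, C]" "[C, h]" "[]"] by simp
  moreover have "mcong K3_relations (C # h # replicate k C @ v) (C # replicate k C @ h # v)"
    using mcong_append[OF Suc, of "[C]" "[]"] by simp
  ultimately show ?case
    by (auto intro: mcong.trans)
qed (simp add: mcong.refl)

text \<open>
  The relations suffice to rewrite a generator followed by a normal form into a normal form, after
  the generator has been moved past the leading powers of \<open>c\<close>; the remaining words have length at
  most three.
\<close>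

lemma mcong_Cons_normal_word:
  "mcong K3_relations (g # normal_word m) (normal_word (kmult (kgen_value g) m))"
proof (cases "g = C")
  case True
  then show ?thesis
    by (cases m rule: normal_word.cases) (simp_all add: mcong.refl)
next
  case False
  have *: "mcong K3_relations (g # replicate k C @ v) (replicate l C @ v')"
    if "mcong K3_relations (g # v) (replicate d C @ v')" "l = k + d" for k l d v v'
  proof -
    have "mcong K3_relations (replicate k C @ g # v) (replicate k C @ replicate d C @ v')"
      using mcong_append[OF that(1), of "replicate k C" "[]"] by simp
    then show ?thesis
      using mcong_C_commute mcong.trans that(2) by (metis append.assoc replicate_add)
  qed
  have rels: "mcong K3_relations [H1, H2, H1] [H1]" "mcong K3_relations [H2, H1, H2] [H2]"
      "mcong K3_relations [H1, H1] [C, H1]" "mcong K3_relations [H2, H2] [C, H2]"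
    by (auto intro: mcong.rel simp: K3_relations_def)
  have rels': "mcong K3_relations [H1, H1, H2] [C, H1, H2]"
      "mcong K3_relations [H2, H2, H1] [C, H2, H1]"
    using mcong_append[OF rels(3), of "[]" "[H2]"] mcong_append[OF rels(4), of "[]" "[H1]"]
    by simp_all
  consider "g = H1" | "g = H2"
    using False by (cases g) auto
  then show ?thesis
  proof cases
    case 1
    then show ?thesis
      using *[where d = 0 and v = "[]" and v' = "[H1]"] *[where d = 0 and v = "[H2]" and v' = "[H1, H2]"]
        *[where d = 0 and v = "[H2, H1]" and v' = "[H1]"]
        *[where d = 1 and v = "[H1]" and v' = "[H1]"]
        *[where d = 1 and v = "[H1, H2]" and v' = "[H1, H2]"]
      by (cases m rule: normal_word.cases) (simp_all add: rels rels' mcong.refl replicate_app_Cons_same)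
  next
    case 2
    then show ?thesis
      using *[where d = 0 and v = "[]" and v' = "[H2]"] *[where d = 0 and v = "[H1]" and v' = "[H2, H1]"]
        *[where d = 0 and v = "[H1, H2]" and v' = "[H2]"]
        *[where d = 1 and v = "[H2]" and v' = "[H2]"]
        *[where d = 1 and v = "[H2, H1]" and v' = "[H2, H1]"]
      by (cases m rule: normal_word.cases) (simp_all add: rels rels' mcong.refl replicate_app_Cons_same)
  qed
qed

lemma mcong_normal_word: "mcong K3_relations u (normal_word (kprod kgen_value u))"
proof (induction u)
  case (Cons g u)
  from mcong_append[OF this, of "[g]" "[]"] show ?case
    using mcong_Cons_normal_word[of g "kprod kgen_value u"] by (auto intro: mcong.trans)
qed (simp add: mcong.refl)

lemma mcong_K3_iff: "mcong K3_relations u v \<longleftrightarrow> kprod kgen_value u = kprod kgen_value v"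
  using mcong_kprod mcong_normal_word by (metis mcong.sym mcong.trans)

text \<open>
  The model is exact (\<open>mcong_K3_iff\<close>) and each of its elements is the value of some word, so
  substitutions into \<open>K3\<close> are the same as maps from letters into the model.
\<close>

lemma identity_holds_K3_iff_kprod:
  "identity_holds K3 w w' \<longleftrightarrow> (\<forall>\<theta>. kprod \<theta> w = kprod \<theta> w')"
proof -
  have "(\<forall>u. kprod (\<lambda>x. kprod kgen_value (u x)) w = kprod (\<lambda>x. kprod kgen_value (u x)) w')
      \<longleftrightarrow> (\<forall>\<theta>. kprod \<theta> w = kprod \<theta> w')" (is "?l \<longleftrightarrow> ?r")
  proof
    assume l: ?l
    show ?r
    proof
      fix \<theta>
      show "kprod \<theta> w = kprod \<theta> w'"
        using l[rule_format, of "\<lambda>x. normal_word (\<theta> x)"] by simp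
    qed
  qed simp
  then show ?thesis
    by (simp add: K3_def identity_holds_presented_monoid mcong_K3_iff kprod_concat)
qed

section \<open>Identities as equality of adjacent pairs\<close>

text \<open>
  With \<open>None\<close> as the initial \<open>p\<close>, these are the adjacent pairs of the word with a border \<open>None\<close> added
  at each side. The borders make first and last letters visible as ordinary pairs, and ensure that
  each occurrence of a letter is the second component of exactly one pair.
\<close>

primrec adj :: "'a option \<Rightarrow> 'a list \<Rightarrow> ('a option \<times> 'a option) list" where
  "adj p [] = [(p, None)]"
| "adj p (x # u) = (p, Some x) # adj (Some x) u"

lemma map_snd_adj: "map snd (adj p u) = map Some u @ [None]"
  by (induction u arbitrary: p) simp_all

lemma length_adj: "length (adj p u) = Suc (length u)"
  by (induction u arbitrary: p) simp_all

lemma adj_from_None: "(None, q) \<in> set (adj p u) \<longleftrightarrow>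
    p = None \<and> q = (case u of [] \<Rightarrow> None | x # _ \<Rightarrow> Some x)"
  by (induction u arbitrary: p) auto

lemma count_adj_from_None: "count_list (adj p u) (None, q) =
    of_bool (p = None \<and> q = (case u of [] \<Rightarrow> None | x # _ \<Rightarrow> Some x))"
  by (induction u arbitrary: p) auto

lemma adj_to_None: "(r, None) \<in> set (adj p u) \<longleftrightarrow> r = (if u = [] then p else Some (last u))"
  by (induction u arbitrary: p) auto

lemma count_adj_to_None: "count_list (adj p u) (r, None) =
    of_bool (r = (if u = [] then p else Some (last u)))"
  by (induction u arbitrary: p) auto

lemma adj_subset: "(Some x, q) \<in> set (adj p u) \<Longrightarrow> Some x = p \<or> x \<in> set u"
  "(q, Some x) \<in> set (adj p u) \<Longrightarrow> x \<in> set u"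
  by (induction u arbitrary: p) auto

fun coincides :: "('a \<Rightarrow> bool) \<Rightarrow> ('a \<Rightarrow> bool) \<Rightarrow> 'a option \<times> 'a option \<Rightarrow> nat" where
  "coincides i j (Some x, Some y) = of_bool (j x = i y)"
| "coincides i j _ = 0"

text \<open>
  Letters sent to powers of \<open>c\<close> only contribute to the exponent; in what remains, each adjacent pair
  whose inner indices agree contributes one more \<open>c\<close>.
\<close>

lemma kprod_eq:
  fixes \<theta> :: "'a \<Rightarrow> nat \<times> (bool \<times> bool) option"
  defines "i \<equiv> \<lambda>x. fst (the (snd (\<theta> x)))" and "j \<equiv> \<lambda>x. snd (the (snd (\<theta> x)))"
    and "Z \<equiv> {x. snd (\<theta> x) = None}"
  shows "kprod \<theta> w =
    (let u = filter (\<lambda>x. x \<notin> Z) w in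
      (sum_list (map (fst \<circ> \<theta>) w) + sum_list (map (coincides i j) (adj None u)),
       if u = [] then None else Some (i (hd u), j (last u))))"
proof (induction w)
  case (Cons x w)
  obtain k a where \<theta>: "\<theta> x = (k, a)"
    by fastforce
  show ?case
  proof (cases a)
    case None
    then show ?thesis
      using Cons \<theta> by (simp add: Z_def Let_def)
  next
    case (Some ij)
    then have "x \<notin> Z" "ij = (i x, j x)"
      using \<theta> by (simp_all add: Z_def i_def j_def)
    then show ?thesis
      using Cons \<theta> Some by (cases "filter (\<lambda>x. x \<notin> Z) w") (simp_all add: Let_def)
  qed
qed simp

text \<open>
  For truth values read as 0 and 1, \<open>[a = b] = 1 - [a] - [b] + 2 [a] [b]\<close>. With \<open>a\<close> for \<open>z = x\<close> and
  \<open>b\<close> for \<open>z' = y\<close>, this expresses the number of pairs \<open>(x, y)\<close> by the numbers of coincidences for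
  four choices of the bits. It is stated without subtraction.
\<close>

lemma two_count_adj:
  "2 * count_list ps (Some x, Some y)
     + sum_list (map (coincides (\<lambda>z. False) (\<lambda>z. z = x)) ps)
     + sum_list (map (coincides (\<lambda>z. z = y) (\<lambda>z. False)) ps)
   = sum_list (map (coincides (\<lambda>z. z = y) (\<lambda>z. z = x)) ps)
     + sum_list (map (coincides (\<lambda>z. False) (\<lambda>z. False)) ps)"
proof (induction ps)
  case (Cons pq ps)
  obtain p q where "pq = (p, q)" by fastforce
  with Cons show ?case
    by (cases p; cases q) auto
qed simp

lemma identity_holds_K3_iff_adj:
  "identity_holds K3 w w' \<longleftrightarrow>
    (\<forall>Z. mset (adj None (filter (\<lambda>x. x \<notin> Z) w)) = mset (adj None (filter (\<lambda>x. x \<notin> Z) w')))"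
  unfolding identity_holds_K3_iff_kprod
proof (intro iffI allI)
  fix Z :: "'a set"
  assume all: "\<forall>\<theta>. kprod \<theta> w = kprod \<theta> w'"
  define u where "u = filter (\<lambda>x. x \<notin> Z) w"
  define u' where "u' = filter (\<lambda>x. x \<notin> Z) w'"
  have eq: "sum_list (map (coincides i j) (adj None u)) = sum_list (map (coincides i j) (adj None u'))
      \<and> (u = [] \<longleftrightarrow> u' = []) \<and> (u \<noteq> [] \<longrightarrow> i (hd u) = i (hd u') \<and> j (last u) = j (last u'))" for i j
  proof -
    \<comment> \<open>Erase the letters in \<open>Z\<close> and send each other letter \<open>x\<close> to \<open>e_ij\<close> for the given bits.\<close>
    define \<theta> where "\<theta> = (\<lambda>x. (0::nat, if x \<in> Z then None else Some (i x, j x)))"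
    have Z: "{x. snd (\<theta> x) = None} = Z"
      by (auto simp: \<theta>_def)
    have coin: "sum_list (map (coincides (\<lambda>x. fst (the (snd (\<theta> x)))) (\<lambda>x. snd (the (snd (\<theta> x)))))
        (adj None (filter (\<lambda>x. x \<notin> Z) v))) = sum_list (map (coincides i j) (adj None (filter (\<lambda>x. x \<notin> Z) v)))" for v
    proof (rule arg_cong[where f = sum_list], rule map_cong[OF HOL.refl])
      fix pq
      assume pq: "pq \<in> set (adj None (filter (\<lambda>x. x \<notin> Z) v))"
      show "coincides (\<lambda>x. fst (the (snd (\<theta> x)))) (\<lambda>x. snd (the (snd (\<theta> x)))) pq = coincides i j pq"
      proof (cases "(i, j, pq)" rule: coincides.cases)
        case (1 _ _ x y)
        then have "x \<notin> Z" "y \<notin> Z"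
          using pq adj_subset by fastforce+
        with 1 show ?thesis
          by (simp add: \<theta>_def)
      qed simp_all
    qed
    have zero: "sum_list (map (fst \<circ> \<theta>) v) = 0" for v
      by (induction v) (simp_all add: \<theta>_def)
    have ends: "fst (the (snd (\<theta> (hd v)))) = i (hd v) \<and> snd (the (snd (\<theta> (last v)))) = j (last v)"
      if "v \<noteq> []" "set v \<inter> Z = {}" for v
    proof -
      have "hd v \<notin> Z" "last v \<notin> Z"
        using that hd_in_set last_in_set by blast+
      then show ?thesis
        by (simp add: \<theta>_def)
    qed
    have "kprod \<theta> v = (let u = filter (\<lambda>x. x \<notin> Z) v in
        (sum_list (map (coincides i j) (adj None u)),
         if u = [] then None else Some (i (hd u), j (last u))))" for v
    proof -
      have "set (filter (\<lambda>x. x \<notin> Z) v) \<inter> Z = {}"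
        by auto
      then show ?thesis
        unfolding kprod_eq Z coin zero Let_def using ends by simp
    qed
    then have "(sum_list (map (coincides i j) (adj None u)),
         if u = [] then None else Some (i (hd u), j (last u))) =
        (sum_list (map (coincides i j) (adj None u')),
         if u' = [] then None else Some (i (hd u'), j (last u')))"
      using all unfolding u_def u'_def by metis
    then show ?thesis
      by (simp split: if_splits)
  qed
  \<comment> \<open>Indicator functions of single letters as bits separate the end letters.\<close>
  have hd: "hd u = hd u'" if "u \<noteq> []"
    using eq[of "\<lambda>x. x = hd u'" "\<lambda>x. x = hd u'"] that by blast
  have last: "last u = last u'" if "u \<noteq> []"
    using eq[of "\<lambda>x. x = last u'" "\<lambda>x. x = last u'"] that by blast
  have empty: "u = [] \<longleftrightarrow> u' = []"
    using eq by blast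
  have "count_list (adj None u) (p, q) = count_list (adj None u') (p, q)" for p q
  proof (cases p)
    case None
    then show ?thesis
      using hd empty by (auto simp: count_adj_from_None split: list.splits)
  next
    case (Some x)
    show ?thesis
    proof (cases q)
      case None
      then show ?thesis
        using last empty by (auto simp: count_adj_to_None)
    next
      case (Some y)
      have "sum_list (map (coincides i j) (adj None u)) = sum_list (map (coincides i j) (adj None u'))" for i j
        using eq by blast
      with two_count_adj[of "adj None u" x y] two_count_adj[of "adj None u'" x y]
      have "count_list (adj None u) (Some x, Some y) = count_list (adj None u') (Some x, Some y)"
        by (metis add_right_cancel mult_cancel1 zero_neq_numeral)
      with Some \<open>p = Some x\<close> show ?thesis
        by simp
    qed
  qed
  then show "mset (adj None u) = mset (adj None u')"
    by (intro multiset_eqI) (auto simp: count_mset)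
next
  fix \<theta> :: "'a \<Rightarrow> nat \<times> (bool \<times> bool) option"
  assume adj: "\<forall>Z. mset (adj None (filter (\<lambda>x. x \<notin> Z) w)) = mset (adj None (filter (\<lambda>x. x \<notin> Z) w'))"
  \<comment> \<open>Second components list the letters of a word, so the case of no deletion settles
    the exponents contributed by the substitution itself.\<close>
  have "mset (map snd (adj None w)) = mset (map snd (adj None w'))"
    using adj[rule_format, of "{}"] by simp
  then have "image_mset the (image_mset Some (mset w)) = image_mset the (image_mset Some (mset w'))"
    by (simp add: map_snd_adj)
  then have w: "mset w = mset w'"
    by (simp add: multiset.map_comp o_def)
  define Z where "Z = {x. snd (\<theta> x) = None}"
  define u where "u = filter (\<lambda>x. x \<notin> Z) w"
  define u' where "u' = filter (\<lambda>x. x \<notin> Z) w'"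
  have uu': "mset (adj None u) = mset (adj None u')"
    unfolding u_def u'_def using adj by blast
  have sums: "sum_list (map f (adj None u)) = sum_list (map f (adj None u'))" for f :: "_ \<Rightarrow> nat"
    using arg_cong[OF uu', of "\<lambda>M. sum_mset (image_mset f M)"]
    by (simp only: sum_mset_sum_list flip: mset_map)
  have sums': "sum_list (map f w) = sum_list (map f w')" for f :: "_ \<Rightarrow> nat"
    using arg_cong[OF w, of "\<lambda>M. sum_mset (image_mset f M)"]
    by (simp only: sum_mset_sum_list flip: mset_map)
  have set: "set (adj None u) = set (adj None u')"
    using uu' by (rule mset_eq_setD)
  have "(case u of [] \<Rightarrow> None | x # _ \<Rightarrow> Some x) = (case u' of [] \<Rightarrow> None | x # _ \<Rightarrow> Some x)"
    using set adj_from_None[of _ None u] adj_from_None[of _ None u'] by blast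
  moreover have "(if u = [] then None else Some (last u)) = (if u' = [] then None else Some (last u'))"
    using set adj_to_None[of _ None u] adj_to_None[of _ None u'] by blast
  ultimately show "kprod \<theta> w = kprod \<theta> w'"
    unfolding kprod_eq Z_def[symmetric] Let_def u_def[symmetric] u'_def[symmetric] sums sums'
    by (auto split: list.splits if_splits)
qed

section \<open>Deleting contents of factors suffices\<close>

text \<open>
  A minimal element \<open>z\<close> of \<open>M + N\<close> has no member but its own copies below it, so its multiplicities
  in \<open>M\<close> and \<open>N\<close> agree; remove one copy from each and repeat. This replaces Moebius inversion.
\<close>

lemma mset_eqI_down_set_sizes:
  fixes M N :: "'a::order multiset"
  assumes "\<And>z. z \<in># M + N \<Longrightarrow> size {#a \<in># M. a \<le> z#} = size {#a \<in># N. a \<le> z#}"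
  shows "M = N"
  using assms
proof (induction M arbitrary: N rule: measure_induct_rule[where f = size])
  case (less M)
  show ?case
  proof (cases "M + N = {#}")
    case False
    then obtain z where z: "z \<in># M + N" and min: "\<And>a. a \<in># M + N \<Longrightarrow> a \<le> z \<Longrightarrow> a = z"
      using finite_has_minimal[of "set_mset (M + N)"] by (metis finite_set_mset set_mset_eq_empty_iff)
    have only: "{#a \<in># M. a \<le> z#} = {#a \<in># M. a = z#}" "{#a \<in># N. a \<le> z#} = {#a \<in># N. a = z#}"
      using min by (auto intro!: filter_mset_cong)
    have "count M z = count N z"
      using less.prems[OF z] unfolding only by (simp add: count_conv_size_mset[symmetric] filter_eq_replicate_mset)
    moreover from this z have "z \<in># M" "z \<in># N"
      by (auto simp flip: count_greater_zero_iff)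
    then obtain M' N' where MN: "M = add_mset z M'" "N = add_mset z N'"
      by (metis mset_add)
    have "M' = N'"
    proof (rule less.IH)
      fix y
      assume "y \<in># M' + N'"
      then show "size {#a \<in># M'. a \<le> y#} = size {#a \<in># N'. a \<le> y#}"
        using less.prems[of y] by (auto simp: MN split: if_splits)
    qed (simp add: MN)
    then show ?thesis
      by (simp add: MN)
  qed simp
qed

text \<open>
  \<open>gaps p q None w\<close> collects, for every occurrence of \<open>p\<close> and every later occurrence of \<open>q\<close> in \<open>w\<close>,
  the set of letters strictly between them, the borders \<open>None\<close> included as possible \<open>p\<close> and \<open>q\<close>. The
  argument \<open>r\<close> is the symbol just before the current suffix, and \<open>A\<close> collects what has been passed
  since \<open>p\<close>.
\<close>

primrec gaps_to :: "'a option \<Rightarrow> 'a set \<Rightarrow> 'a list \<Rightarrow> 'a set multiset" where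
  "gaps_to q A [] = (if q = None then {#A#} else {#})"
| "gaps_to q A (x # u) = (if q = Some x then {#A#} else {#}) + gaps_to q (insert x A) u"

primrec gaps :: "'a option \<Rightarrow> 'a option \<Rightarrow> 'a option \<Rightarrow> 'a list \<Rightarrow> 'a set multiset" where
  "gaps p q r [] = (if r = p then gaps_to q {} [] else {#})"
| "gaps p q r (x # u) = (if r = p then gaps_to q {} (x # u) else {#}) + gaps p q (Some x) u"

lemma gaps_to_factor: "B \<in># gaps_to q A u \<Longrightarrow> \<exists>v t. u = v @ t \<and> B = A \<union> set v"
proof (induction u arbitrary: A)
  case (Cons x u)
  show ?case
  proof (cases "B \<in># gaps_to q (insert x A) u")
    case True
    then obtain v t where "u = v @ t" "B = insert x A \<union> set v"
      using Cons.IH by blast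
    then have "x # u = (x # v) @ t" "B = A \<union> set (x # v)"
      by auto
    then show ?thesis
      by blast
  next
    case False
    then have "x # u = [] @ (x # u)" "B = A \<union> set []"
      using Cons.prems by (auto split: if_splits)
    then show ?thesis
      by blast
  qed
qed (auto split: if_splits)

lemma gaps_factor: "B \<in># gaps p q r u \<Longrightarrow> \<exists>s v t. u = s @ v @ t \<and> B = set v"
proof (induction u arbitrary: r)
  case (Cons x u)
  show ?case
  proof (cases "B \<in># gaps p q (Some x) u")
    case True
    then obtain s v t where "u = s @ v @ t" "B = set v"
      using Cons.IH by blast
    then have "x # u = (x # s) @ v @ t" "B = set v"
      by auto
    then show ?thesis
      by blast
  next
    case False
    then have "B \<in># gaps_to q {} (x # u)"
      using Cons.prems by (auto split: if_splits)
    from gaps_to_factor[OF this] obtain v t where "x # u = [] @ v @ t" "B = set v"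
      by auto
    then show ?thesis
      by blast
  qed
qed (auto split: if_splits)

text \<open>
  Beyond the first letter outside \<open>Z\<close>, the passed letters are never contained in \<open>Z\<close> again, so at most
  one occurrence of \<open>q\<close> counts.
\<close>

lemma size_gaps_to:
  assumes "q \<notin> Some ` Z"
  shows "size {#A \<in># gaps_to q B u. A \<subseteq> Z#} =
    of_bool (B \<subseteq> Z \<and> q = (case filter (\<lambda>x. x \<notin> Z) u of [] \<Rightarrow> None | x # _ \<Rightarrow> Some x))"
  using assms by (induction u arbitrary: B) auto

lemma count_adj_filter:
  assumes "p \<notin> Some ` Z" "q \<notin> Some ` Z"
  shows "count_list (adj r (filter (\<lambda>x. x \<notin> Z) u)) (p, q) = size {#A \<in># gaps p q r u. A \<subseteq> Z#}"
proof (induction u arbitrary: r)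
  case Nil
  then show ?case
    by auto
next
  case (Cons x u)
  have split_gaps: "size {#A \<in># gaps p q r u. A \<subseteq> Z#} =
      of_bool (r = p) * size {#A \<in># gaps_to q {} u. A \<subseteq> Z#} + size {#A \<in># gaps p q (Some x) u. A \<subseteq> Z#}"
    if "Some x \<noteq> p"
    using that by (cases u) auto
  show ?case
  proof (cases "x \<in> Z")
    case True
    then have "Some x \<noteq> p" "Some x \<noteq> q"
      using assms by auto
    then show ?thesis
      using True Cons[of r] split_gaps by (auto simp: size_gaps_to[OF assms(2)])
  next
    case False
    then have "size {#A \<in># gaps_to q {} (x # u). A \<subseteq> Z#} = of_bool (q = Some x)"
      using size_gaps_to[OF assms(2), of "{}" "x # u"] by simp
    then show ?thesis
      using False Cons[of "Some x"] by (auto simp del: gaps_to.simps)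
  qed
qed

text \<open>
  Fix a pair \<open>(p, q)\<close>. Gaps that contain \<open>p\<close> or \<open>q\<close> never lie below a set \<open>Z\<close> avoiding both, so they
  may be discarded; the multisets \<open>J\<close> of the other gaps have only contents of factors avoiding \<open>p\<close> and
  \<open>q\<close> as members, at which the hypothesis gives equal counts.
\<close>

lemma adj_eq_if_adj_eq_factors:
  assumes factors: "\<And>s v t. w = s @ v @ t \<or> w' = s @ v @ t \<Longrightarrow>
      mset (adj None (filter (\<lambda>x. x \<notin> set v) w)) = mset (adj None (filter (\<lambda>x. x \<notin> set v) w'))"
  shows "mset (adj None (filter (\<lambda>x. x \<notin> Z) w)) = mset (adj None (filter (\<lambda>x. x \<notin> Z) w'))"
proof (rule multiset_eqI)
  fix pq :: "'a option \<times> 'a option"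
  obtain p q where pq: "pq = (p, q)"
    by fastforce
  show "count (mset (adj None (filter (\<lambda>x. x \<notin> Z) w))) pq = count (mset (adj None (filter (\<lambda>x. x \<notin> Z) w'))) pq"
  proof (cases "p \<in> Some ` Z \<or> q \<in> Some ` Z")
    case True
    have "(p, q) \<notin> set (adj None (filter (\<lambda>x. x \<notin> Z) v))" for v
      using True by (auto dest: adj_subset)
    then have "count_list (adj None (filter (\<lambda>x. x \<notin> Z) v)) (p, q) = 0" for v
      by (simp add: count_list_0_iff)
    then show ?thesis
      by (simp add: pq count_mset)
  next
    case False
    define J where "J = (\<lambda>v. {#A \<in># gaps p q None v. p \<notin> Some ` A \<and> q \<notin> Some ` A#})"
    have count: "count_list (adj None (filter (\<lambda>x. x \<notin> Y) v)) (p, q) = size {#A \<in># J v. A \<subseteq> Y#}"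
      if "p \<notin> Some ` Y" "q \<notin> Some ` Y" for Y v
    proof -
      have "{#A \<in># J v. A \<subseteq> Y#} = {#A \<in># gaps p q None v. A \<subseteq> Y#}"
        using that unfolding J_def filter_filter_mset by (intro filter_mset_cong) auto
      then show ?thesis
        using count_adj_filter[OF that] by simp
    qed
    have "J w = J w'"
    proof (rule mset_eqI_down_set_sizes)
      fix Y
      assume Y: "Y \<in># J w + J w'"
      then have "p \<notin> Some ` Y" "q \<notin> Some ` Y"
        by (auto simp: J_def)
      moreover from Y obtain v where "Y \<in># gaps p q None v" "v = w \<or> v = w'"
        by (auto simp: J_def)
      then obtain s u t where "w = s @ u @ t \<or> w' = s @ u @ t" "Y = set u"
        using gaps_factor by metis
      ultimately show "size {#A \<in># J w. A \<subseteq> Y#} = size {#A \<in># J w'. A \<subseteq> Y#}"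
        using factors[of s u t] by (metis count count_mset)
    qed
    then show ?thesis
      using False by (simp add: pq count_mset count)
  qed
qed

section \<open>Reasoning about programs and their running time\<close>

text \<open>
  Weakest precondition in which the postcondition \<open>Q\<close> also sees the running time. For loop-free
  programs it can be computed by rewriting (\<open>exec_simps\<close>).
\<close>

definition exec :: "com \<Rightarrow> 'x state \<Rightarrow> (nat \<Rightarrow> 'x state \<Rightarrow> bool) \<Rightarrow> bool" where
  "exec p \<sigma> Q \<longleftrightarrow> (\<exists>n \<tau>. runs p \<sigma> n \<tau> \<and> Q n \<tau>)"

lemma exec_mono:
  "exec p \<sigma> Q \<Longrightarrow> (\<And>n \<tau>. Q n \<tau> \<Longrightarrow> Q' n \<tau>) \<Longrightarrow> exec p \<sigma> Q'"
  unfolding exec_def by blast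

lemma exec_Skip: "exec Skip \<sigma> Q \<longleftrightarrow> Q 1 \<sigma>"
  unfolding exec_def by (fastforce intro: runs.Skip elim: runs_SkipE)

lemma exec_Assign: "exec (Assign i e) \<sigma> Q \<longleftrightarrow> Q (cost e + 1) (\<sigma>(i := eval_expr e \<sigma>))"
  unfolding exec_def by (metis runs.Assign runs_AssignE)

lemma exec_Seq: "exec (Seq p q) \<sigma> Q \<longleftrightarrow> exec p \<sigma> (\<lambda>m \<rho>. exec q \<rho> (\<lambda>n. Q (m + n)))"
  unfolding exec_def by (fastforce intro: runs.Seq elim: runs_SeqE)

lemma exec_If:
  "exec (com.If e p q) \<sigma> Q \<longleftrightarrow>
    exec (if eval_expr e \<sigma> \<noteq> Null then p else q) \<sigma> (\<lambda>n. Q (cost e + 1 + n))"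
  unfolding exec_def
  by (cases "eval_expr e \<sigma> = Null") (fastforce intro: runs.IfTrue runs.IfFalse elim: runs_IfE)+

lemmas exec_simps [simp] = exec_Skip exec_Assign exec_Seq exec_If

lemma exec_While:
  "exec (While e p) \<sigma> Q \<longleftrightarrow>
    (if eval_expr e \<sigma> = Null then Q (cost e + 1) \<sigma>
     else exec p \<sigma> (\<lambda>m \<rho>. exec (While e p) \<rho> (\<lambda>n. Q (cost e + 1 + m + n))))"
proof (cases "eval_expr e \<sigma> = Null")
  case True
  have "runs (While e p) \<sigma> n \<tau> \<longleftrightarrow> n = cost e + 1 \<and> \<tau> = \<sigma>" for n \<tau>
    using True by (auto intro: WhileFalse[simplified] elim: runs_WhileE)
  with True show ?thesis
    by (simp add: exec_def)
next
  case False
  have "runs (While e p) \<sigma> n \<tau> \<longleftrightarrow>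
      (\<exists>m \<rho> k. runs p \<sigma> m \<rho> \<and> runs (While e p) \<rho> k \<tau> \<and> n = cost e + 1 + m + k)" for n \<tau>
  proof
    assume "runs (While e p) \<sigma> n \<tau>"
    then show "\<exists>m \<rho> k. runs p \<sigma> m \<rho> \<and> runs (While e p) \<rho> k \<tau> \<and> n = cost e + 1 + m + k"
      by (rule runs_WhileE) (use False in simp, auto)
  qed (use False in \<open>blast intro: WhileTrue\<close>)
  with False show ?thesis
    unfolding exec_def by (simp, blast)
qed

primrec tree_of_list :: "'x tree list \<Rightarrow> 'x tree" where
  "tree_of_list [] = Null"
| "tree_of_list (t # ts) = Node t (tree_of_list ts)"

lemma tree_of_word_eq: "tree_of_word w = tree_of_list (map Letter w)"
  by (induction w) simp_all

lemma tree_of_list_eq_Null [simp]: "tree_of_list ts = Null \<longleftrightarrow> ts = []"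
  by (cases ts) simp_all

definition foreach :: "nat \<Rightarrow> nat \<Rightarrow> com \<Rightarrow> com" where
  "foreach i v p = While (Var i) (Seq (Assign v (Left (Var i))) (Seq (Assign i (Right (Var i))) p))"

text \<open>
  The invariant \<open>I\<close> takes the elements still to be processed. An iteration costs 8 steps besides the
  body: 2 for the test and 3 for each of the assignments to \<open>v\<close> and \<open>i\<close>.
\<close>

lemma exec_foreach:
  assumes "\<sigma> i = tree_of_list (map f xs)" "I xs \<sigma>" "i \<noteq> v"
    and step: "\<And>x ys \<rho>. I (x # ys) \<rho> \<Longrightarrow>
      exec p (\<rho>(v := f x, i := tree_of_list (map f ys)))
        (\<lambda>n \<tau>. n \<le> b \<and> \<tau> i = tree_of_list (map f ys) \<and> I ys \<tau>)"
  shows "exec (foreach i v p) \<sigma> (\<lambda>n \<tau>. n \<le> length xs * (b + 8) + 2 \<and> I [] \<tau>)"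
  using assms(1,2)
proof (induction xs arbitrary: \<sigma>)
  case Nil
  then show ?case
    by (simp add: foreach_def exec_While)
next
  case (Cons x xs)
  have "exec p (\<sigma>(v := f x, i := tree_of_list (map f xs)))
      (\<lambda>m \<rho>. exec (foreach i v p) \<rho> (\<lambda>n \<tau>. 8 + m + n \<le> length (x # xs) * (b + 8) + 2 \<and> I [] \<tau>))"
    by (rule exec_mono[OF step[OF Cons.prems(2)]]) (auto intro: exec_mono[OF Cons.IH])
  then show ?case
    using Cons.prems(1) \<open>i \<noteq> v\<close>
    by (subst foreach_def, subst exec_While) (simp add: foreach_def eval_nat_numeral)
qed

primrec option_tree :: "'x option \<Rightarrow> 'x tree" where
  "option_tree None = Null"
| "option_tree (Some x) = Letter x"

fun pair_tree :: "'x option \<times> 'x option \<Rightarrow> 'x tree" where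
  "pair_tree (p, q) = Node (option_tree p) (option_tree q)"

text \<open>
  \<open>EqLetter\<close> does not identify two empty trees, which represent the border; the test for it is done
  separately.
\<close>

definition if_eq :: "expr \<Rightarrow> expr \<Rightarrow> com \<Rightarrow> com \<Rightarrow> com" where
  "if_eq d e p q = com.If (EqLetter d e) p (com.If d q (com.If e q p))"

text \<open>
  The time of the comparison depends on the path taken, hence the quantification over all
  admissible times.
\<close>

lemma exec_if_eq:
  assumes "eval_expr d \<sigma> = option_tree s" "eval_expr e \<sigma> = option_tree t"
    and "exec (if s = t then p else q) \<sigma> (\<lambda>n \<tau>. \<forall>k \<le> n + 2 * (cost d + cost e) + 4. Q k \<tau>)"
  shows "exec (if_eq d e p q) \<sigma> Q"
  using assms unfolding if_eq_def
  by (cases s; cases t) (auto split: if_splits elim!: exec_mono)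

section \<open>The decision procedure\<close>

text \<open>
  Registers: 0 and 1 hold the words, 2 the answer, 3 and 4 the outer loop over suffixes of the list
  that is first built up in 3, 5 a list
  of symbols to be deleted, 6 and 7 the loop over prefixes, and 8 and 9 the two lists of adjacent
  pairs. Higher registers are scratch. Each program leaves the registers below those it works on
  unchanged, except for its output; this frame condition is what the enclosing loop relies on.

  Here, register 13 tells whether the letter in register 11 occurs in the list in register 5.
\<close>

definition member_com :: com where
  "member_com =
    Seq (Assign 13 NullE) (Seq (Assign 14 (Var 5))
      (foreach 14 15 (com.If (EqLetter (Var 15) (Var 11)) (Assign 13 (Var 11)) Skip)))"

lemma exec_member_com:
  assumes "\<sigma> 5 = tree_of_list (map option_tree B)" "\<sigma> 11 = Letter x"
  shows "exec member_com \<sigma> (\<lambda>n \<tau>. n \<le> 14 * length B + 6 \<and>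
    (\<tau> 13 \<noteq> Null \<longleftrightarrow> Some x \<in> set B) \<and> (\<forall>i<13. \<tau> i = \<sigma> i))"
proof -
  let ?I = "\<lambda>ys \<tau>. (\<forall>i<13. \<tau> i = \<sigma> i) \<and> (\<tau> 13 \<noteq> Null \<or> Some x \<in> set ys \<longleftrightarrow> Some x \<in> set B)"
  have "exec (foreach 14 15 (com.If (EqLetter (Var 15) (Var 11)) (Assign 13 (Var 11)) Skip))
      (\<sigma>(13 := Null, 14 := \<sigma> 5)) (\<lambda>n \<tau>. n \<le> length B * (6 + 8) + 2 \<and> ?I [] \<tau>)"
  proof (rule exec_foreach[where f = option_tree])
    fix y ys \<rho>
    assume "?I (y # ys) \<rho>"
    then show "exec (com.If (EqLetter (Var 15) (Var 11)) (Assign 13 (Var 11)) Skip)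
        (\<rho>(15 := option_tree y, 14 := tree_of_list (map option_tree ys)))
        (\<lambda>n \<tau>. n \<le> 6 \<and> \<tau> 14 = tree_of_list (map option_tree ys) \<and> ?I ys \<tau>)"
      using assms(2) by (cases y) auto
  qed (use assms in auto)
  then show ?thesis
    unfolding member_com_def by (auto elim: exec_mono)
qed

text \<open>
  The shortened word is never stored: register 12 remembers the last symbol that was kept, starting
  with the border. The pairs come out in reversed order, which their multiset does not see.
\<close>

definition adj_com :: "nat \<Rightarrow> nat \<Rightarrow> com" where
  "adj_com s d =
    Seq (Assign d NullE) (Seq (Assign 12 NullE) (Seq (Assign 10 (Var s))
      (Seq (foreach 10 11 (Seq member_com (com.If (Var 13) Skip
          (Seq (Assign d (NodeE (NodeE (Var 12) (Var 11)) (Var d))) (Assign 12 (Var 11))))))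
        (Assign d (NodeE (NodeE (Var 12) NullE) (Var d))))))"

lemma exec_adj_com:
  assumes "\<sigma> s = tree_of_list (map Letter w)" "\<sigma> 5 = tree_of_list (map option_tree B)"
    and "s < 10" "d < 10" "d \<noteq> 5" "d \<noteq> s"
  shows "exec (adj_com s d) \<sigma> (\<lambda>n \<tau>. n \<le> length w * (14 * length B + 24) + 14 \<and>
    (\<exists>ps. \<tau> d = tree_of_list (map pair_tree ps) \<and>
      mset ps = mset (adj None (filter (\<lambda>x. Some x \<notin> set B) w))) \<and>
    (\<forall>i<10. i \<noteq> d \<longrightarrow> \<tau> i = \<sigma> i))"
proof -
  let ?I = "\<lambda>ys \<tau>. (\<forall>i<10. i \<noteq> d \<longrightarrow> \<tau> i = \<sigma> i) \<and>
    (\<exists>ps p. \<tau> d = tree_of_list (map pair_tree ps) \<and> \<tau> 12 = option_tree p \<and>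
      mset ps + mset (adj p (filter (\<lambda>x. Some x \<notin> set B) ys)) =
      mset (adj None (filter (\<lambda>x. Some x \<notin> set B) w)))"
  let ?p = "Seq member_com (com.If (Var 13) Skip
    (Seq (Assign d (NodeE (NodeE (Var 12) (Var 11)) (Var d))) (Assign 12 (Var 11))))"
  have "exec (foreach 10 11 ?p) (\<sigma>(d := Null, 12 := Null, 10 := \<sigma> s))
      (\<lambda>n \<tau>. n \<le> length w * ((14 * length B + 16) + 8) + 2 \<and> ?I [] \<tau>)"
  proof (rule exec_foreach[where f = Letter])
    fix y ys \<rho>
    assume I: "?I (y # ys) \<rho>"
    then obtain ps p where ps: "\<rho> d = tree_of_list (map pair_tree ps)" "\<rho> 12 = option_tree p"
        "mset ps + mset (adj p (filter (\<lambda>x. Some x \<notin> set B) (y # ys))) =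
         mset (adj None (filter (\<lambda>x. Some x \<notin> set B) w))"
      by blast
    let ?\<rho> = "\<rho>(11 := Letter y, 10 := tree_of_list (map Letter ys))"
    have "?\<rho> 5 = tree_of_list (map option_tree B)"
      using I assms by simp
    moreover have "?\<rho> 11 = Letter y"
      by simp
    ultimately have m: "exec member_com ?\<rho> (\<lambda>n \<tau>. n \<le> 14 * length B + 6 \<and>
      (\<tau> 13 \<noteq> Null \<longleftrightarrow> Some y \<in> set B) \<and> (\<forall>i<13. \<tau> i = ?\<rho> i))"
      by (rule exec_member_com)
    show "exec ?p ?\<rho> (\<lambda>n \<tau>. n \<le> 14 * length B + 16 \<and> \<tau> 10 = tree_of_list (map Letter ys) \<and> ?I ys \<tau>)"
    proof (simp only: exec_simps, rule exec_mono[OF m], elim conjE)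
      fix n \<tau>
      assume n: "n \<le> 14 * length B + 6" and \<tau>: "\<tau> 13 \<noteq> Null \<longleftrightarrow> Some y \<in> set B"
        "\<forall>i<13. \<tau> i = ?\<rho> i"
      show "exec (if eval_expr (Var 13) \<tau> \<noteq> Null then Skip
          else Seq (Assign d (NodeE (NodeE (Var 12) (Var 11)) (Var d))) (Assign 12 (Var 11))) \<tau>
        (\<lambda>na \<tau>. n + (cost (Var 13) + 1 + na) \<le> 14 * length B + 16 \<and>
           \<tau> 10 = tree_of_list (map Letter ys) \<and> ?I ys \<tau>)"
      proof (cases "Some y \<in> set B")
        case True
        then show ?thesis
          using n \<tau> I assms(4) by simp
      next
        case False
        have "\<exists>qs q. Node (Node (option_tree p) (Letter y)) (tree_of_list (map pair_tree ps)) =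
              tree_of_list (map pair_tree qs) \<and> Letter y = option_tree q \<and>
            mset qs + mset (adj q (filter (\<lambda>x. Some x \<notin> set B) ys)) =
            mset (adj None (filter (\<lambda>x. Some x \<notin> set B) w))"
          using ps(3) False by (intro exI[of _ "(p, Some y) # ps"] exI[of _ "Some y"]) simp
        then show ?thesis
          using False n \<tau> I ps(1,2) assms(4) by simp
      qed
    qed
  qed (use assms in \<open>auto intro!: exI[of _ "[]"] exI[of _ None]\<close>)
  then show ?thesis
    unfolding adj_com_def using assms
    apply (auto elim!: exec_mono)
    subgoal by (simp add: add.commute)
    subgoal for n \<tau> ps p by (rule exI[of _ "(p, None) # ps"]) simp
    done
qed

text \<open>
  Equality of letters is the only test available, so multisets are compared by removing equal
  entries. Register 10 holds the entry \<open>p\<close> to be removed from the list in 9, register 11 records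
  whether it has been met, and register 12 collects the entries that stay, so that only one copy is
  dropped.
\<close>

definition remove_com :: com where
  "remove_com =
    Seq (Assign 11 NullE) (Seq (Assign 12 NullE)
      (Seq (foreach 9 13 (com.If (Var 11) (Assign 12 (NodeE (Var 13) (Var 12)))
          (if_eq (Left (Var 13)) (Left (Var 10))
            (if_eq (Right (Var 13)) (Right (Var 10))
              (Assign 11 (NodeE NullE NullE)) (Assign 12 (NodeE (Var 13) (Var 12))))
            (Assign 12 (NodeE (Var 13) (Var 12))))))
        (Assign 9 (Var 12))))"

lemma exec_remove_com:
  assumes "\<sigma> 9 = tree_of_list (map pair_tree qs)" "\<sigma> 10 = pair_tree p"
  shows "exec remove_com \<sigma> (\<lambda>n \<tau>. n \<le> 38 * length qs + 8 \<and>
    (\<exists>rs. \<tau> 9 = tree_of_list (map pair_tree rs) \<and> mset rs = mset qs - {#p#}) \<and>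
    (\<tau> 11 \<noteq> Null \<longleftrightarrow> p \<in> set qs) \<and> (\<forall>i<9. \<tau> i = \<sigma> i))"
proof -
  let ?I = "\<lambda>ys \<tau>. (\<forall>i<11. i \<noteq> 9 \<longrightarrow> \<tau> i = \<sigma> i) \<and>
    (\<exists>rs. \<tau> 12 = tree_of_list (map pair_tree rs) \<and>
      (if \<tau> 11 = Null then p \<notin> set rs \<and> mset rs + mset ys = mset qs
       else add_mset p (mset rs + mset ys) = mset qs))"
  let ?p = "com.If (Var 11) (Assign 12 (NodeE (Var 13) (Var 12)))
      (if_eq (Left (Var 13)) (Left (Var 10))
        (if_eq (Right (Var 13)) (Right (Var 10))
          (Assign 11 (NodeE NullE NullE)) (Assign 12 (NodeE (Var 13) (Var 12))))
        (Assign 12 (NodeE (Var 13) (Var 12))))"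
  obtain p1 p2 where p: "p = (p1, p2)"
    by fastforce
  have loop: "exec (foreach 9 13 ?p) (\<sigma>(11 := Null, 12 := Null))
      (\<lambda>n \<tau>. n \<le> length qs * (30 + 8) + 2 \<and> ?I [] \<tau>)"
  proof (rule exec_foreach[where f = pair_tree])
    fix y ys \<rho>
    assume I: "?I (y # ys) \<rho>"
    then obtain rs where rs: "\<rho> 12 = tree_of_list (map pair_tree rs)"
        "if \<rho> 11 = Null then p \<notin> set rs \<and> mset rs + mset (y # ys) = mset qs
          else add_mset p (mset rs + mset (y # ys)) = mset qs"
      by blast
    obtain y1 y2 where y: "y = (y1, y2)"
      by fastforce
    let ?\<rho> = "\<rho>(13 := pair_tree y, 9 := tree_of_list (map pair_tree ys))"
    have \<rho>: "\<forall>i<11. i \<noteq> 9 \<longrightarrow> \<rho> i = \<sigma> i" "\<rho> 10 = Node (option_tree p1) (option_tree p2)"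
      using I assms(2) by (simp_all add: p)
    have push: "exec (Assign 12 (NodeE (Var 13) (Var 12))) ?\<rho>
        (\<lambda>n \<tau>. n = 4 \<and> \<tau> 9 = tree_of_list (map pair_tree ys) \<and> ?I ys \<tau>)"
      if "\<rho> 11 \<noteq> Null \<or> p \<noteq> y"
      using rs \<rho>(1) that by (auto intro!: exI[of _ "y # rs"])
    have found: "exec (Assign 11 (NodeE NullE NullE)) ?\<rho>
        (\<lambda>n \<tau>. n = 4 \<and> \<tau> 9 = tree_of_list (map pair_tree ys) \<and> ?I ys \<tau>)"
      if "\<rho> 11 = Null" "p = y"
      using rs \<rho>(1) that by (auto intro!: exI[of _ rs])
    show "exec ?p ?\<rho> (\<lambda>n \<tau>. n \<le> 30 \<and> \<tau> 9 = tree_of_list (map pair_tree ys) \<and> ?I ys \<tau>)"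
    proof (cases "\<rho> 11 = Null")
      case False
      then have "exec (Assign 12 (NodeE (Var 13) (Var 12))) ?\<rho>
          (\<lambda>n \<tau>. cost (Var 11) + 1 + n \<le> 30 \<and> \<tau> 9 = tree_of_list (map pair_tree ys) \<and> ?I ys \<tau>)"
        by (intro exec_mono[OF push]) simp_all
      with False show ?thesis
        unfolding exec_If by (simp del: exec_simps)
    next
      case True
      have "exec (if_eq (Left (Var 13)) (Left (Var 10))
        (if_eq (Right (Var 13)) (Right (Var 10))
          (Assign 11 (NodeE NullE NullE)) (Assign 12 (NodeE (Var 13) (Var 12))))
        (Assign 12 (NodeE (Var 13) (Var 12)))) ?\<rho>
        (\<lambda>n \<tau>. n \<le> 28 \<and> \<tau> 9 = tree_of_list (map pair_tree ys) \<and> ?I ys \<tau>)"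
      proof (rule exec_if_eq[of _ _ y1 _ p1])
        show "exec (if y1 = p1 then if_eq (Right (Var 13)) (Right (Var 10))
            (Assign 11 (NodeE NullE NullE)) (Assign 12 (NodeE (Var 13) (Var 12)))
          else Assign 12 (NodeE (Var 13) (Var 12))) ?\<rho>
          (\<lambda>n \<tau>. \<forall>k\<le>n + 2 * (cost (Left (Var 13)) + cost (Left (Var 10))) + 4.
             k \<le> 28 \<and> \<tau> 9 = tree_of_list (map pair_tree ys) \<and> ?I ys \<tau>)"
        proof (cases "y1 = p1")
          case False
          then have "p \<noteq> y"
            by (simp add: p y)
          then show ?thesis
            unfolding if_not_P[OF False] by (intro exec_mono[OF push]) simp_all
        next
          case y1: True
          have "exec (if y2 = p2 then Assign 11 (NodeE NullE NullE)
              else Assign 12 (NodeE (Var 13) (Var 12))) ?\<rho>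
            (\<lambda>n \<tau>. n = 4 \<and> \<tau> 9 = tree_of_list (map pair_tree ys) \<and> ?I ys \<tau>)"
            using push found True y1 p y by (cases "y2 = p2") (simp_all del: exec_simps)
          then have "exec (if_eq (Right (Var 13)) (Right (Var 10))
              (Assign 11 (NodeE NullE NullE)) (Assign 12 (NodeE (Var 13) (Var 12)))) ?\<rho>
            (\<lambda>n \<tau>. n \<le> 16 \<and> \<tau> 9 = tree_of_list (map pair_tree ys) \<and> ?I ys \<tau>)"
            by (intro exec_if_eq[of _ _ y2 _ p2]) (simp_all add: \<rho>(2) y exec_mono del: exec_simps)
          then show ?thesis
            unfolding if_P[OF y1] by (rule exec_mono) simp
        qed
      qed (simp_all add: \<rho>(2) y)
      then have "exec (if_eq (Left (Var 13)) (Left (Var 10))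
        (if_eq (Right (Var 13)) (Right (Var 10))
          (Assign 11 (NodeE NullE NullE)) (Assign 12 (NodeE (Var 13) (Var 12))))
        (Assign 12 (NodeE (Var 13) (Var 12)))) ?\<rho>
        (\<lambda>n \<tau>. cost (Var 11) + 1 + n \<le> 30 \<and> \<tau> 9 = tree_of_list (map pair_tree ys) \<and> ?I ys \<tau>)"
        by (rule exec_mono) simp
      with True show ?thesis
        unfolding exec_If by (simp del: exec_simps)
    qed
  qed (use assms in auto)
  have final: "(\<exists>rs. \<tau> 12 = tree_of_list (map pair_tree rs) \<and> mset rs = mset qs - {#p#}) \<and>
      (\<tau> 11 \<noteq> Null \<longleftrightarrow> p \<in> set qs)" if "?I [] \<tau>" for \<tau>
  proof -
    obtain rs where rs: "\<tau> 12 = tree_of_list (map pair_tree rs)"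
        "if \<tau> 11 = Null then p \<notin> set rs \<and> mset rs + mset [] = mset qs
          else add_mset p (mset rs + mset []) = mset qs"
      using \<open>?I [] \<tau>\<close> by blast
    from rs(2) have "mset rs = mset qs - {#p#}"
      by (metis add_mset_remove_trivial diff_single_trivial set_mset_mset mset.simps(1) add_0_right)
    moreover from rs(2) have "\<tau> 11 \<noteq> Null \<longleftrightarrow> p \<in> set qs"
      by (metis set_mset_mset union_single_eq_member mset.simps(1) add_0_right)
    ultimately show ?thesis
      using rs(1) by blast
  qed
  have "exec (foreach 9 13 ?p) (\<sigma>(11 := Null, 12 := Null)) (\<lambda>n \<tau>. n + 6 \<le> 38 * length qs + 8 \<and>
    ((\<exists>rs. \<tau> 12 = tree_of_list (map pair_tree rs) \<and> mset rs = mset qs - {#p#}) \<and>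
    (\<tau> 11 \<noteq> Null \<longleftrightarrow> p \<in> set qs)) \<and> (\<forall>i<9. \<tau> i = \<sigma> i))"
  proof (rule exec_mono[OF loop])
    fix n \<tau>
    assume *: "n \<le> length qs * (30 + 8) + 2 \<and> ?I [] \<tau>"
    show "n + 6 \<le> 38 * length qs + 8 \<and>
      ((\<exists>rs. \<tau> 12 = tree_of_list (map pair_tree rs) \<and> mset rs = mset qs - {#p#}) \<and>
      (\<tau> 11 \<noteq> Null \<longleftrightarrow> p \<in> set qs)) \<and> (\<forall>i<9. \<tau> i = \<sigma> i)"
      by (intro conjI[OF _ conjI[OF final]] conjunct2[OF *]) (use * in simp_all)
  qed
  then show ?thesis
    unfolding remove_com_def by simp
qed

definition match_com :: com where
  "match_com =
    Seq (foreach 8 10 (Seq remove_com (com.If (Var 11) Skip (Assign 2 NullE))))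
      (com.If (Var 9) (Assign 2 NullE) Skip)"

lemma exec_match_com:
  assumes "\<sigma> 8 = tree_of_list (map pair_tree ps)" "\<sigma> 9 = tree_of_list (map pair_tree qs)"
  shows "exec match_com \<sigma> (\<lambda>n \<tau>. n \<le> length ps * (38 * length qs + 20) + 6 \<and>
    (\<tau> 2 \<noteq> Null \<longleftrightarrow> \<sigma> 2 \<noteq> Null \<and> mset ps = mset qs) \<and> (\<forall>i<8. i \<noteq> 2 \<longrightarrow> \<tau> i = \<sigma> i))"
proof -
  \<comment> \<open>The last conjunct survives a failed removal: then the answer is cleared, and the multisets
    before the removal were different already.\<close>
  let ?I = "\<lambda>ys \<tau>. (\<forall>i<8. i \<noteq> 2 \<longrightarrow> \<tau> i = \<sigma> i) \<and>
    (\<exists>rs. \<tau> 9 = tree_of_list (map pair_tree rs) \<and> length rs \<le> length qs \<and>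
      (\<tau> 2 \<noteq> Null \<and> mset ys = mset rs \<longleftrightarrow> \<sigma> 2 \<noteq> Null \<and> mset ps = mset qs))"
  let ?p = "Seq remove_com (com.If (Var 11) Skip (Assign 2 NullE))"
  have "exec (foreach 8 10 ?p) \<sigma> (\<lambda>n \<tau>. n \<le> length ps * ((38 * length qs + 12) + 8) + 2 \<and> ?I [] \<tau>)"
  proof (rule exec_foreach[where f = pair_tree])
    fix y ys \<rho>
    assume I: "?I (y # ys) \<rho>"
    then obtain rs where rs: "\<rho> 9 = tree_of_list (map pair_tree rs)" "length rs \<le> length qs"
        "\<rho> 2 \<noteq> Null \<and> mset (y # ys) = mset rs \<longleftrightarrow> \<sigma> 2 \<noteq> Null \<and> mset ps = mset qs"
      by blast
    let ?\<rho> = "\<rho>(10 := pair_tree y, 8 := tree_of_list (map pair_tree ys))"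
    have r: "exec remove_com ?\<rho> (\<lambda>n \<tau>. n \<le> 38 * length rs + 8 \<and>
        (\<exists>ts. \<tau> 9 = tree_of_list (map pair_tree ts) \<and> mset ts = mset rs - {#y#}) \<and>
        (\<tau> 11 \<noteq> Null \<longleftrightarrow> y \<in> set rs) \<and> (\<forall>i<9. \<tau> i = ?\<rho> i))"
      by (rule exec_remove_com) (simp_all add: rs)
    show "exec ?p ?\<rho> (\<lambda>n \<tau>. n \<le> 38 * length qs + 12 \<and> \<tau> 8 = tree_of_list (map pair_tree ys) \<and> ?I ys \<tau>)"
    proof (simp only: exec_simps, rule exec_mono[OF r], elim conjE exE)
      fix n \<tau> ts
      assume n: "n \<le> 38 * length rs + 8" and ts: "\<tau> 9 = tree_of_list (map pair_tree ts)"
          "mset ts = mset rs - {#y#}"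
        and \<tau>: "\<tau> 11 \<noteq> Null \<longleftrightarrow> y \<in> set rs" "\<forall>i<9. \<tau> i = ?\<rho> i"
      have len: "length ts \<le> length qs"
      proof -
        have "size (mset ts) \<le> size (mset rs)"
          unfolding ts(2) by (rule size_mset_mono) simp
        then show ?thesis
          using rs(2) by simp
      qed
      have n': "n + 4 \<le> 38 * length qs + 12"
        using n rs(2) by simp
      show "exec (if eval_expr (Var 11) \<tau> \<noteq> Null then Skip else Assign 2 NullE) \<tau>
         (\<lambda>na \<tau>. n + (cost (Var 11) + 1 + na) \<le> 38 * length qs + 12 \<and>
            \<tau> 8 = tree_of_list (map pair_tree ys) \<and> ?I ys \<tau>)"
      proof (cases "y \<in> set rs")
        case True
        then have "mset (y # ys) = mset rs \<longleftrightarrow> mset ys = mset ts"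
          by (metis add_mset_remove_trivial insert_DiffM mset.simps(2) set_mset_mset ts(2))
        then have "\<tau> 2 \<noteq> Null \<and> mset ys = mset ts \<longleftrightarrow> \<sigma> 2 \<noteq> Null \<and> mset ps = mset qs"
          using rs(3) \<tau>(2) by simp
        then show ?thesis
          using True n' \<tau> I ts(1) len by (auto intro!: exI[of _ ts])
      next
        case False
        then have "mset (y # ys) \<noteq> mset rs"
          by (metis list.set_intros(1) mset_eq_setD)
        then show ?thesis
          using False n' \<tau> I ts(1) len rs(3) by (auto intro!: exI[of _ ts])
      qed
    qed
  qed (use assms in auto)
  then show ?thesis
    unfolding match_com_def exec_Seq
  proof (rule exec_mono, elim conjE exE)
    fix n \<tau> rs
    assume "n \<le> length ps * ((38 * length qs + 12) + 8) + 2"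
    then have "n + 4 \<le> length ps * (38 * length qs + 20) + 6"
      by (simp add: algebra_simps)
    moreover assume "\<forall>i<8. i \<noteq> 2 \<longrightarrow> \<tau> i = \<sigma> i" "\<tau> 9 = tree_of_list (map pair_tree rs)"
      "\<tau> 2 \<noteq> Null \<and> mset [] = mset rs \<longleftrightarrow> \<sigma> 2 \<noteq> Null \<and> mset ps = mset qs"
    ultimately show "exec (com.If (Var 9) (Assign 2 NullE) Skip) \<tau> (\<lambda>m \<tau>.
        n + m \<le> length ps * (38 * length qs + 20) + 6 \<and>
        (\<tau> 2 \<noteq> Null \<longleftrightarrow> \<sigma> 2 \<noteq> Null \<and> mset ps = mset qs) \<and> (\<forall>i<8. i \<noteq> 2 \<longrightarrow> \<tau> i = \<sigma> i))"
      by (cases "rs = []") simp_all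
  qed
qed

definition check_com :: com where
  "check_com = Seq (adj_com 0 8) (Seq (adj_com 1 9) match_com)"

definition check_time :: "nat \<Rightarrow> nat" where
  "check_time n = 2 * (n * (14 * (n + 1) + 24) + 14) + (n + 1) * (38 * (n + 1) + 20) + 6"

lemma exec_check_com:
  assumes "\<sigma> 0 = tree_of_list (map Letter w)" "\<sigma> 1 = tree_of_list (map Letter w')"
    and "\<sigma> 5 = tree_of_list (map option_tree B)" "length B \<le> length w + length w' + 1"
  shows "exec check_com \<sigma> (\<lambda>n \<tau>. n \<le> check_time (length w + length w') \<and>
    (\<tau> 2 \<noteq> Null \<longleftrightarrow> \<sigma> 2 \<noteq> Null \<and>
      mset (adj None (filter (\<lambda>x. Some x \<notin> set B) w)) = mset (adj None (filter (\<lambda>x. Some x \<notin> set B) w'))) \<and>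
    (\<forall>i<8. i \<noteq> 2 \<longrightarrow> \<tau> i = \<sigma> i))"
proof -
  let ?N = "length w + length w'"
  let ?a = "\<lambda>v. mset (adj None (filter (\<lambda>x. Some x \<notin> set B) v))"
  have time: "k + (m + n) \<le> check_time ?N"
    if "k \<le> length w * (14 * length B + 24) + 14" "m \<le> length w' * (14 * length B + 24) + 14"
      "n \<le> length ps * (38 * length qs + 20) + 6" "mset ps = ?a w" "mset qs = ?a w'"
    for k m n and ps qs :: "('a option \<times> 'a option) list"
  proof -
    have "length ps \<le> ?N + 1" "length qs \<le> ?N + 1"
      using arg_cong[OF that(4), of size] arg_cong[OF that(5), of size]
      by (auto simp: length_adj intro: trans_le_add1 trans_le_add2)
    then have "length ps * (38 * length qs + 20) \<le> (?N + 1) * (38 * (?N + 1) + 20)"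
      by (intro mult_le_mono add_le_mono) simp_all
    note calc = this
    have "length v * (14 * length B + 24) \<le> ?N * (14 * (?N + 1) + 24)" if "v = w \<or> v = w'" for v
      using that assms(4) by (intro mult_le_mono add_le_mono) auto
    note calc = calc this[of w, OF disjI1[OF HOL.refl]] this[of w', OF disjI2[OF HOL.refl]]
    have "k + (m + n) \<le> 2 * (x + 14) + y + 6"
      if "c \<le> y" "a \<le> x" "b \<le> x" "k \<le> a + 14" "m \<le> b + 14" "n \<le> c + 6" for a b c x y :: nat
      using that by presburger
    from this[OF calc that(1-3)] show ?thesis
      unfolding check_time_def .
  qed
  have 1: "exec (adj_com 0 8) \<sigma> (\<lambda>n \<tau>. n \<le> length w * (14 * length B + 24) + 14 \<and>
      (\<exists>ps. \<tau> 8 = tree_of_list (map pair_tree ps) \<and> mset ps = ?a w) \<and>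
      (\<forall>i<10. i \<noteq> 8 \<longrightarrow> \<tau> i = \<sigma> i))"
    by (rule exec_adj_com) (simp_all add: assms)
  show ?thesis
    unfolding check_com_def exec_simps
  proof (rule exec_mono[OF 1], elim conjE exE)
    fix k \<rho> ps
    assume k: "k \<le> length w * (14 * length B + 24) + 14"
      and ps: "\<rho> 8 = tree_of_list (map pair_tree ps)" "mset ps = ?a w"
      and \<rho>: "\<forall>i<10. i \<noteq> 8 \<longrightarrow> \<rho> i = \<sigma> i"
    have 2: "exec (adj_com 1 9) \<rho> (\<lambda>n \<tau>. n \<le> length w' * (14 * length B + 24) + 14 \<and>
        (\<exists>qs. \<tau> 9 = tree_of_list (map pair_tree qs) \<and> mset qs = ?a w') \<and>
        (\<forall>i<10. i \<noteq> 9 \<longrightarrow> \<tau> i = \<rho> i))"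
      by (rule exec_adj_com) (use assms \<rho> in simp_all)
    show "exec (adj_com 1 9) \<rho> (\<lambda>m \<rho>. exec match_com \<rho> (\<lambda>n \<tau>. k + (m + n) \<le> check_time ?N \<and>
      (\<tau> 2 \<noteq> Null \<longleftrightarrow> \<sigma> 2 \<noteq> Null \<and> ?a w = ?a w') \<and> (\<forall>i<8. i \<noteq> 2 \<longrightarrow> \<tau> i = \<sigma> i)))"
    proof (rule exec_mono[OF 2], elim conjE exE)
      fix m \<pi> qs
      assume m: "m \<le> length w' * (14 * length B + 24) + 14"
        and qs: "\<pi> 9 = tree_of_list (map pair_tree qs)" "mset qs = ?a w'"
        and \<pi>: "\<forall>i<10. i \<noteq> 9 \<longrightarrow> \<pi> i = \<rho> i"
      have "\<pi> 8 = tree_of_list (map pair_tree ps)"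
        using ps(1) \<pi> by simp
      from exec_match_com[OF this qs(1)]
      show "exec match_com \<pi> (\<lambda>n \<tau>. k + (m + n) \<le> check_time ?N \<and>
        (\<tau> 2 \<noteq> Null \<longleftrightarrow> \<sigma> 2 \<noteq> Null \<and> ?a w = ?a w') \<and> (\<forall>i<8. i \<noteq> 2 \<longrightarrow> \<tau> i = \<sigma> i))"
        by (rule exec_mono) (use time[OF k m _ ps(2) qs(2)] \<pi> \<rho> ps(2) qs(2) in simp)
    qed
  qed
qed

text \<open>
  The two predicates follow the loops of the program. Only proper prefixes of suffixes are visited;
  the final \<open>None\<close> in \<open>identity_holds_K3_iff_all_factors\<close> makes every factor one of these, including
  the empty one, and is never itself a letter to be deleted.
\<close>

primrec all_prefixes :: "('a set \<Rightarrow> bool) \<Rightarrow> 'a set \<Rightarrow> 'a list \<Rightarrow> bool" where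
  "all_prefixes P D [] \<longleftrightarrow> True"
| "all_prefixes P D (x # xs) \<longleftrightarrow> P D \<and> all_prefixes P (insert x D) xs"

primrec all_factors :: "('a set \<Rightarrow> bool) \<Rightarrow> 'a list \<Rightarrow> bool" where
  "all_factors P [] \<longleftrightarrow> True"
| "all_factors P (x # xs) \<longleftrightarrow> all_prefixes P {} (x # xs) \<and> all_factors P xs"

lemma all_prefixesD:
  "all_prefixes P D (d @ t) \<Longrightarrow> t \<noteq> [] \<Longrightarrow> P (D \<union> set d)"
proof (induction d arbitrary: D)
  case Nil
  then show ?case by (cases t) auto
next
  case (Cons x d)
  then show ?case by fastforce
qed

lemma all_factorsD: "all_factors P (s @ d @ t) \<Longrightarrow> t \<noteq> [] \<Longrightarrow> P (set d)"
proof (induction s)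
  case Nil
  then have "all_prefixes P {} (d @ t)"
    by (cases "d @ t") auto
  then show ?case
    using Nil all_prefixesD by fastforce
qed simp

lemma all_prefixesI: "(\<And>D. P D) \<Longrightarrow> all_prefixes P D xs"
  by (induction xs arbitrary: D) simp_all

lemma all_factorsI: "(\<And>D. P D) \<Longrightarrow> all_factors P xs"
  by (induction xs) (simp_all add: all_prefixesI)

text \<open>
  A single list serves for the factors of both words. They are reversed because pushing letters
  onto a list reverses them, which does not affect contents of factors; the additional factors
  that straddle both words do no harm.
\<close>

lemma identity_holds_K3_iff_all_factors:
  "identity_holds K3 w w' \<longleftrightarrow>
    all_factors (\<lambda>D. mset (adj None (filter (\<lambda>x. Some x \<notin> D) w)) =
        mset (adj None (filter (\<lambda>x. Some x \<notin> D) w')))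
      (map Some (rev w @ rev w') @ [None])" (is "_ \<longleftrightarrow> all_factors ?P ?v")
proof
  assume "identity_holds K3 w w'"
  then have "?P D" for D
    using identity_holds_K3_iff_adj[of w w'] by (auto dest: spec[of _ "{x. Some x \<in> D}"])
  then show "all_factors ?P ?v"
    by (rule all_factorsI)
next
  assume all: "all_factors ?P ?v"
  show "identity_holds K3 w w'"
    unfolding identity_holds_K3_iff_adj
  proof (rule allI, rule adj_eq_if_adj_eq_factors)
    fix s v t
    assume "w = s @ v @ t \<or> w' = s @ v @ t"
    then have "\<exists>s' t'. ?v = s' @ map Some (rev v) @ t' \<and> t' \<noteq> []"
    proof
      assume "w = s @ v @ t"
      then have "?v = map Some (rev t) @ map Some (rev v) @ (map Some (rev s @ rev w') @ [None])"
        by simp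
      then show ?thesis
        by blast
    next
      assume "w' = s @ v @ t"
      then have "?v = map Some (rev w @ rev t) @ map Some (rev v) @ (map Some (rev s) @ [None])"
        by simp
      then show ?thesis
        by blast
    qed
    then obtain s' t' where v: "?v = s' @ map Some (rev v) @ t'" and "t' \<noteq> []"
      by blast
    from all[unfolded v] \<open>t' \<noteq> []\<close> have "?P (set (map Some (rev v)))"
      by (rule all_factorsD)
    then show "mset (adj None (filter (\<lambda>x. x \<notin> set v) w)) = mset (adj None (filter (\<lambda>x. x \<notin> set v) w'))"
      by (simp add: inj_image_mem_iff)
  qed
qed

definition prefixes_com :: com where
  "prefixes_com =
    Seq (Assign 5 NullE) (Seq (Assign 6 (NodeE (Var 4) (Var 3)))
      (foreach 6 7 (Seq check_com (Assign 5 (NodeE (Var 7) (Var 5))))))"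

definition factors_com :: com where
  "factors_com = foreach 3 4 prefixes_com"

context
  fixes w w' :: "'x list" and P and N
  defines "P \<equiv> \<lambda>D. mset (adj None (filter (\<lambda>x. Some x \<notin> D) w)) =
      mset (adj None (filter (\<lambda>x. Some x \<notin> D) w'))"
    and "N \<equiv> length w + length w'"
begin

lemma exec_prefixes_com:
  assumes "\<sigma> 0 = tree_of_list (map Letter w)" "\<sigma> 1 = tree_of_list (map Letter w')"
    and "\<sigma> 4 = option_tree x" "\<sigma> 3 = tree_of_list (map option_tree xs)" "length xs \<le> N"
  shows "exec prefixes_com \<sigma> (\<lambda>n \<tau>. n \<le> (N + 1) * (check_time N + 12) + 8 \<and>
    (\<tau> 2 \<noteq> Null \<longleftrightarrow> \<sigma> 2 \<noteq> Null \<and> all_prefixes P {} (x # xs)) \<and>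
    (\<forall>i<5. i \<noteq> 2 \<longrightarrow> \<tau> i = \<sigma> i))"
proof -
  let ?I = "\<lambda>ys \<tau>. (\<forall>i<5. i \<noteq> 2 \<longrightarrow> \<tau> i = \<sigma> i) \<and>
    (\<exists>B. \<tau> 5 = tree_of_list (map option_tree B) \<and> length B + length ys \<le> N + 1 \<and>
      (\<tau> 2 \<noteq> Null \<and> all_prefixes P (set B) ys \<longleftrightarrow> \<sigma> 2 \<noteq> Null \<and> all_prefixes P {} (x # xs)))"
  let ?p = "Seq check_com (Assign 5 (NodeE (Var 7) (Var 5)))"
  have "exec (foreach 6 7 ?p) (\<sigma>(5 := Null, 6 := Node (\<sigma> 4) (\<sigma> 3)))
      (\<lambda>n \<tau>. n \<le> length (x # xs) * ((check_time N + 4) + 8) + 2 \<and> ?I [] \<tau>)"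
  proof (rule exec_foreach[where f = option_tree])
    fix y ys \<rho>
    assume I: "?I (y # ys) \<rho>"
    then obtain B where B: "\<rho> 5 = tree_of_list (map option_tree B)" "length B + length (y # ys) \<le> N + 1"
        "\<rho> 2 \<noteq> Null \<and> all_prefixes P (set B) (y # ys) \<longleftrightarrow> \<sigma> 2 \<noteq> Null \<and> all_prefixes P {} (x # xs)"
      by blast
    let ?\<rho> = "\<rho>(7 := option_tree y, 6 := tree_of_list (map option_tree ys))"
    have c: "exec check_com ?\<rho> (\<lambda>n \<tau>. n \<le> check_time (length w + length w') \<and>
        (\<tau> 2 \<noteq> Null \<longleftrightarrow> ?\<rho> 2 \<noteq> Null \<and>
          mset (adj None (filter (\<lambda>x. Some x \<notin> set B) w)) = mset (adj None (filter (\<lambda>x. Some x \<notin> set B) w'))) \<and>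
        (\<forall>i<8. i \<noteq> 2 \<longrightarrow> \<tau> i = ?\<rho> i))"
      by (rule exec_check_com) (use I B assms in \<open>simp_all add: N_def\<close>)
    show "exec ?p ?\<rho> (\<lambda>n \<tau>. n \<le> check_time N + 4 \<and> \<tau> 6 = tree_of_list (map option_tree ys) \<and> ?I ys \<tau>)"
      unfolding exec_simps
    proof (rule exec_mono[OF c], elim conjE)
      fix n \<tau>
      assume n: "n \<le> check_time (length w + length w')"
        and 2: "\<tau> 2 \<noteq> Null \<longleftrightarrow> ?\<rho> 2 \<noteq> Null \<and>
          mset (adj None (filter (\<lambda>x. Some x \<notin> set B) w)) = mset (adj None (filter (\<lambda>x. Some x \<notin> set B) w'))"
        and \<tau>: "\<forall>i<8. i \<noteq> 2 \<longrightarrow> \<tau> i = ?\<rho> i"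
      have "\<tau> 2 \<noteq> Null \<and> all_prefixes P (set (y # B)) ys \<longleftrightarrow> \<sigma> 2 \<noteq> Null \<and> all_prefixes P {} (x # xs)"
        using B(3) 2 by (auto simp: P_def)
      moreover have "\<forall>i<5. i \<noteq> 2 \<longrightarrow> \<tau> i = \<sigma> i"
        using conjunct1[OF I] \<tau> by simp
      moreover have "Node (\<tau> 7) (\<tau> 5) = tree_of_list (map option_tree (y # B))"
        using B(1) \<tau> by simp
      ultimately have "?I ys (\<tau>(5 := Node (\<tau> 7) (\<tau> 5)))"
        using B(2) by (intro conjI exI[of _ "y # B"]) simp_all
      then show "n + (cost (NodeE (Var 7) (Var 5)) + 1) \<le> check_time N + 4 \<and>
          (\<tau>(5 := eval_expr (NodeE (Var 7) (Var 5)) \<tau>)) 6 = tree_of_list (map option_tree ys) \<and>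
          ?I ys (\<tau>(5 := eval_expr (NodeE (Var 7) (Var 5)) \<tau>))"
        using n \<tau> by (simp add: N_def)
    qed
  qed (use assms in \<open>auto intro!: exI[of _ "[]"]\<close>)
  moreover have "length (x # xs) * ((check_time N + 4) + 8) \<le> (N + 1) * (check_time N + 12)"
    using assms(5) by (intro mult_le_mono) simp_all
  ultimately show ?thesis
    unfolding prefixes_com_def by (auto elim!: exec_mono)
qed

lemma exec_factors_com:
  assumes "\<sigma> 0 = tree_of_list (map Letter w)" "\<sigma> 1 = tree_of_list (map Letter w')"
    and "\<sigma> 3 = tree_of_list (map option_tree xs)" "length xs \<le> N + 1"
  shows "exec factors_com \<sigma> (\<lambda>n \<tau>. n \<le> (N + 1) * ((N + 1) * (check_time N + 12) + 16) + 2 \<and>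
    (\<tau> 2 \<noteq> Null \<longleftrightarrow> \<sigma> 2 \<noteq> Null \<and> all_factors P xs))"
proof -
  let ?I = "\<lambda>ys \<tau>. (\<forall>i<3. i \<noteq> 2 \<longrightarrow> \<tau> i = \<sigma> i) \<and> length ys \<le> N + 1 \<and>
    (\<tau> 2 \<noteq> Null \<and> all_factors P ys \<longleftrightarrow> \<sigma> 2 \<noteq> Null \<and> all_factors P xs)"
  have "exec (foreach 3 4 prefixes_com) \<sigma>
      (\<lambda>n \<tau>. n \<le> length xs * (((N + 1) * (check_time N + 12) + 8) + 8) + 2 \<and> ?I [] \<tau>)"
  proof (rule exec_foreach[where f = option_tree])
    fix y ys \<rho>
    assume I: "?I (y # ys) \<rho>"
    let ?\<rho> = "\<rho>(4 := option_tree y, 3 := tree_of_list (map option_tree ys))"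
    have "exec prefixes_com ?\<rho> (\<lambda>n \<tau>. n \<le> (N + 1) * (check_time N + 12) + 8 \<and>
        (\<tau> 2 \<noteq> Null \<longleftrightarrow> ?\<rho> 2 \<noteq> Null \<and> all_prefixes P {} (y # ys)) \<and>
        (\<forall>i<5. i \<noteq> 2 \<longrightarrow> \<tau> i = ?\<rho> i))"
      by (rule exec_prefixes_com) (use I assms in simp_all)
    then show "exec prefixes_com ?\<rho> (\<lambda>n \<tau>. n \<le> (N + 1) * (check_time N + 12) + 8 \<and>
        \<tau> 3 = tree_of_list (map option_tree ys) \<and> ?I ys \<tau>)"
      by (rule exec_mono) (use I in auto)
  qed (use assms in auto)
  moreover have "length xs * (((N + 1) * (check_time N + 12) + 8) + 8) \<le>
      (N + 1) * ((N + 1) * (check_time N + 12) + 16)"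
    using assms(4) by (intro mult_le_mono) simp_all
  ultimately show ?thesis
    unfolding factors_com_def by (auto elim!: exec_mono)
qed

end

definition push_com :: "nat \<Rightarrow> com" where
  "push_com s = Seq (Assign 4 (Var s)) (foreach 4 5 (Assign 3 (NodeE (Var 5) (Var 3))))"

lemma exec_push_com:
  assumes "\<sigma> s = tree_of_list (map Letter v)" "\<sigma> 3 = tree_of_list (map option_tree xs)"
  shows "exec (push_com s) \<sigma> (\<lambda>n \<tau>. n \<le> 12 * length v + 4 \<and>
    \<tau> 3 = tree_of_list (map option_tree (map Some (rev v) @ xs)) \<and> (\<forall>i<3. \<tau> i = \<sigma> i))"
proof -
  let ?I = "\<lambda>ys \<tau>. (\<forall>i<3. \<tau> i = \<sigma> i) \<and>
    (\<exists>zs. \<tau> 3 = tree_of_list (map option_tree zs) \<and> map Some (rev ys) @ zs = map Some (rev v) @ xs)"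
  have "exec (foreach 4 5 (Assign 3 (NodeE (Var 5) (Var 3)))) (\<sigma>(4 := \<sigma> s))
      (\<lambda>n \<tau>. n \<le> length v * (4 + 8) + 2 \<and> ?I [] \<tau>)"
  proof (rule exec_foreach[where f = Letter])
    fix y ys \<rho>
    assume I: "?I (y # ys) \<rho>"
    then obtain zs where "\<rho> 3 = tree_of_list (map option_tree zs)"
        "map Some (rev (y # ys)) @ zs = map Some (rev v) @ xs"
      by blast
    then show "exec (Assign 3 (NodeE (Var 5) (Var 3))) (\<rho>(5 := Letter y, 4 := tree_of_list (map Letter ys)))
        (\<lambda>n \<tau>. n \<le> 4 \<and> \<tau> 4 = tree_of_list (map Letter ys) \<and> ?I ys \<tau>)"
      using I by (auto intro!: exI[of _ "Some y # zs"])
  qed (use assms in auto)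
  then show ?thesis
    unfolding push_com_def by (auto elim!: exec_mono)
qed

text \<open>
  Registers 2 and 3 start as a true answer and as the list consisting of the border only.
\<close>

definition K3_identity_com :: com where
  "K3_identity_com =
    Seq (Assign 2 (NodeE NullE NullE)) (Seq (Assign 3 (NodeE NullE NullE))
      (Seq (push_com 1) (Seq (push_com 0) (Seq factors_com (Assign 0 (Var 2))))))"

definition K3_identity_time :: "nat \<Rightarrow> nat" where
  "K3_identity_time n = (n + 1) * ((n + 1) * (check_time n + 12) + 16) + 12 * n + 20"

lemma exec_K3_identity_com:
  "exec K3_identity_com (input w w') (\<lambda>n \<tau>. n \<le> K3_identity_time (length w + length w') \<and>
    (\<tau> 0 \<noteq> Null \<longleftrightarrow> identity_holds K3 w w'))"
proof -
  let ?\<sigma> = "(input w w')(2 := Node Null Null, 3 := Node Null Null)"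
  let ?N = "length w + length w'"
  have \<sigma>: "?\<sigma> 0 = tree_of_list (map Letter w)" "?\<sigma> 1 = tree_of_list (map Letter w')"
      "?\<sigma> 3 = tree_of_list (map option_tree [None])"
    by (simp_all add: input_def tree_of_word_eq)
  have "exec (push_com 1) ?\<sigma> (\<lambda>k \<rho>. exec (push_com 0) \<rho> (\<lambda>m \<pi>. exec factors_com \<pi>
      (\<lambda>n \<tau>. k + (m + n) + 10 \<le> K3_identity_time ?N \<and> (\<tau> 2 \<noteq> Null \<longleftrightarrow> identity_holds K3 w w'))))"
  proof (rule exec_mono[OF exec_push_com[OF \<sigma>(2,3)]], elim conjE)
    fix k \<rho>
    assume k: "k \<le> 12 * length w' + 4" and \<rho>: "\<rho> 3 = tree_of_list (map option_tree (map Some (rev w') @ [None]))"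
      "\<forall>i<3. \<rho> i = ?\<sigma> i"
    have "\<rho> 0 = tree_of_list (map Letter w)"
      using \<rho>(2) \<sigma>(1) by simp
    from exec_push_com[OF this \<rho>(1)]
    show "exec (push_com 0) \<rho> (\<lambda>m \<pi>. exec factors_com \<pi>
      (\<lambda>n \<tau>. k + (m + n) + 10 \<le> K3_identity_time ?N \<and> (\<tau> 2 \<noteq> Null \<longleftrightarrow> identity_holds K3 w w')))"
    proof (rule exec_mono, elim conjE)
      fix m \<pi>
      assume m: "m \<le> 12 * length w + 4"
        and \<pi>: "\<pi> 3 = tree_of_list (map option_tree (map Some (rev w) @ map Some (rev w') @ [None]))"
          "\<forall>i<3. \<pi> i = \<rho> i"
      have "\<pi> 0 = tree_of_list (map Letter w)" "\<pi> 1 = tree_of_list (map Letter w')"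
        using \<rho>(2) \<pi>(2) \<sigma> by simp_all
      from exec_factors_com[OF this \<pi>(1)]
      show "exec factors_com \<pi> (\<lambda>n \<tau>. k + (m + n) + 10 \<le> K3_identity_time ?N \<and>
          (\<tau> 2 \<noteq> Null \<longleftrightarrow> identity_holds K3 w w'))"
        by (rule exec_mono)
          (use k m \<rho>(2) \<pi>(2) in \<open>simp_all add: K3_identity_time_def identity_holds_K3_iff_all_factors\<close>)
    qed
  qed
  then show ?thesis
    unfolding K3_identity_com_def by (auto elim!: exec_mono)
qed

theorem mainTheorem2:
  "\<exists>(p :: com) (P :: nat poly). decides_in_time p
     (identity_holds K3 :: 'x::{countable, infinite} list \<Rightarrow> 'x list \<Rightarrow> bool) (poly P)"
proof (intro exI)
  let ?X = "[:0, 1:] :: nat poly"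
  let ?c = "2 * (?X * (14 * (?X + 1) + 24) + 14) + (?X + 1) * (38 * (?X + 1) + 20) + 6"
  let ?P = "(?X + 1) * ((?X + 1) * (?c + 12) + 16) + 12 * ?X + 20"
  have "poly ?P n = K3_identity_time n" for n
    unfolding K3_identity_time_def check_time_def
    by (simp only: poly_add poly_mult poly_numeral poly_1 poly_pCons poly_0) simp
  then show "decides_in_time K3_identity_com
     (identity_holds K3 :: 'x list \<Rightarrow> 'x list \<Rightarrow> bool) (poly ?P)"
    using exec_K3_identity_com unfolding decides_in_time_def exec_def by metis
qed

end
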